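(* Let $R$ be a commutative ring, $M$ a flat $R$-module, and $v\colon R\to M$ an $R$-linear map. Then: (1) $v$ is pure if and only if $c_M(v(1))=R$. (2) If $M$ is Ohm-Rush, then $\mathrm{Pure}(v)=\mathrm{CPure}(v)=\mathrm{Spec}(R)\setminus\mathbf V(c_M(v(1)))$.
   Context: A map of $R$-modules $M\to N$ is pure (resp. cyclically pure) if for every $R$-module (resp. every cyclic $R$-module) $P$ the induced map $M\otimes_R P\to N\otimes_R P$ is injective. For a map $v$ of $R$-modules, $\mathrm{Pure}(v)$ (resp. $\mathrm{CPure}(v)$) is the set of $\mathfrak p\in\mathrm{Spec}(R)$ such that the localization $v_{\mathfrak p}$ is a pure (resp. cyclically pure) map of $R_{\mathfrak p}$-modules. $\mathbf V(I)$ is the set of primes containing $I$. For $x\in M$, the content $c_M(x)$ is the intersection of all ideals $I$ of $R$ with $x\in IM$. $M$ is Ohm-Rush if $x\in c_M(x)M$ for all $x\in M$. *)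

theory Defs
  imports
    "HOL-Algebra.Generated_Groups"
    "HOL-Algebra.Free_Abelian_Groups"
    "HOL-Algebra.Ideal"
    "HOL-Algebra.Module"
begin

section \<open>Linear maps and tensor products\<close>

definition linear_maps ::
    "('a, 'r) ring_scheme \<Rightarrow> ('a, 'm, 's) module_scheme \<Rightarrow> ('a, 'n, 't) module_scheme \<Rightarrow> ('m \<Rightarrow> 'n) set"
  where "linear_maps R M N =
    {f \<in> carrier M \<rightarrow> carrier N.
       (\<forall>x\<in>carrier M. \<forall>y\<in>carrier M. f (x \<oplus>\<^bsub>M\<^esub> y) = f x \<oplus>\<^bsub>N\<^esub> f y) \<and>
       (\<forall>r\<in>carrier R. \<forall>x\<in>carrier M. f (r \<odot>\<^bsub>M\<^esub> x) = r \<odot>\<^bsub>N\<^esub> f x)}"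

definition self_module :: "('a, 'r) ring_scheme \<Rightarrow> ('a, 'a) module"
  where "self_module R =
    \<lparr>carrier = carrier R, mult = mult R, one = \<one>\<^bsub>R\<^esub>, zero = \<zero>\<^bsub>R\<^esub>, add = add R, smult = mult R\<rparr>"

text \<open>
  The tensor product is the free abelian group on the set of pairs modulo the subgroup generated by
  the bilinearity and balancing relations. It is kept as an abelian group (written multiplicatively,
  like \<^const>\<open>free_Abelian_group\<close> itself): the notions below only ask whether maps between tensor
  products are injective, for which the scalar action is irrelevant.
\<close>

definition tensor_relators ::
    "('a, 'r) ring_scheme \<Rightarrow> ('a, 'm, 's) module_scheme \<Rightarrow> ('a, 'n, 't) module_scheme \<Rightarrow> ('m \<times> 'n \<Rightarrow>\<^sub>0 int) set"
  where "tensor_relators R M N =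
    {frag_of (x \<oplus>\<^bsub>M\<^esub> x', y) - frag_of (x, y) - frag_of (x', y) | x x' y.
       x \<in> carrier M \<and> x' \<in> carrier M \<and> y \<in> carrier N} \<union>
    {frag_of (x, y \<oplus>\<^bsub>N\<^esub> y') - frag_of (x, y) - frag_of (x, y') | x y y'.
       x \<in> carrier M \<and> y \<in> carrier N \<and> y' \<in> carrier N} \<union>
    {frag_of (r \<odot>\<^bsub>M\<^esub> x, y) - frag_of (x, r \<odot>\<^bsub>N\<^esub> y) | r x y.
       r \<in> carrier R \<and> x \<in> carrier M \<and> y \<in> carrier N}"

definition tensor_kernel ::
    "('a, 'r) ring_scheme \<Rightarrow> ('a, 'm, 's) module_scheme \<Rightarrow> ('a, 'n, 't) module_scheme \<Rightarrow> ('m \<times> 'n \<Rightarrow>\<^sub>0 int) set"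
  where "tensor_kernel R M N =
    generate (free_Abelian_group (carrier M \<times> carrier N)) (tensor_relators R M N)"

definition tensor ::
    "('a, 'r) ring_scheme \<Rightarrow> ('a, 'm, 's) module_scheme \<Rightarrow> ('a, 'n, 't) module_scheme \<Rightarrow> ('m \<times> 'n \<Rightarrow>\<^sub>0 int) set monoid"
  where "tensor R M N =
    free_Abelian_group (carrier M \<times> carrier N) Mod tensor_kernel R M N"

text \<open>
  The class of \<open>c\<close> in \<open>M \<otimes> N\<close>, and the map \<open>f \<otimes> g\<close> into \<open>M' \<otimes> N'\<close>. For linear \<open>f\<close> and \<open>g\<close> all members of
  the union are the same coset; the union merely avoids choosing a representative.
\<close>

definition tensor_class ::
    "('a, 'r) ring_scheme \<Rightarrow> ('a, 'm, 's) module_scheme \<Rightarrow> ('a, 'n, 't) module_scheme \<Rightarrow>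
      ('m \<times> 'n \<Rightarrow>\<^sub>0 int) \<Rightarrow> ('m \<times> 'n \<Rightarrow>\<^sub>0 int) set"
  where "tensor_class R M N c =
    tensor_kernel R M N #>\<^bsub>free_Abelian_group (carrier M \<times> carrier N)\<^esub> c"

definition tensor_map ::
    "('a, 'r) ring_scheme \<Rightarrow> ('a, 'm, 's) module_scheme \<Rightarrow> ('a, 'n, 't) module_scheme \<Rightarrow>
      ('k \<Rightarrow> 'm) \<Rightarrow> ('l \<Rightarrow> 'n) \<Rightarrow> ('k \<times> 'l \<Rightarrow>\<^sub>0 int) set \<Rightarrow> ('m \<times> 'n \<Rightarrow>\<^sub>0 int) set"
  where "tensor_map R M' N' f g X =
    (\<Union>c\<in>X. tensor_class R M' N' (frag_extend (\<lambda>(x, y). frag_of (f x, g y)) c))"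


section \<open>Flatness and purity\<close>

text \<open>
  HOL cannot quantify over all types inside a formula, so notions that quantify over all modules take
  as parameter the type \<open>'p\<close> whose subsets carry the test modules. If \<open>lists (carrier R)\<close> injects into
  \<open>'p\<close>, then every finitely generated module over \<open>R\<close>, or over a localization of \<open>R\<close>, is isomorphic to
  one carried by a subset of \<open>'p\<close>.
\<close>

definition flat_module ::
    "'p itself \<Rightarrow> ('a, 'r) ring_scheme \<Rightarrow> ('a, 'm, 's) module_scheme \<Rightarrow> bool"
  where "flat_module U R M \<longleftrightarrow>
    (\<forall>(A :: ('a, 'p) module) (B :: ('a, 'p) module) f.
       module R A \<and> module R B \<and> f \<in> linear_maps R A B \<and> inj_on f (carrier A) \<longrightarrow>
       inj_on (tensor_map R M B id f) (carrier (tensor R M A)))"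

definition pure_map ::
    "'p itself \<Rightarrow> ('a, 'r) ring_scheme \<Rightarrow> ('a, 'm, 's) module_scheme \<Rightarrow> ('a, 'n, 't) module_scheme \<Rightarrow>
      ('m \<Rightarrow> 'n) \<Rightarrow> bool"
  where "pure_map U R M N v \<longleftrightarrow>
    (\<forall>P :: ('a, 'p) module. module R P \<longrightarrow>
       inj_on (tensor_map R N P v id) (carrier (tensor R M P)))"

definition cyclic_module :: "('a, 'r) ring_scheme \<Rightarrow> ('a, 'm, 's) module_scheme \<Rightarrow> bool"
  where "cyclic_module R P \<longleftrightarrow>
    module R P \<and> (\<exists>x\<in>carrier P. carrier P = (\<lambda>r. r \<odot>\<^bsub>P\<^esub> x) ` carrier R)"

definition cyclically_pure_map ::
    "'p itself \<Rightarrow> ('a, 'r) ring_scheme \<Rightarrow> ('a, 'm, 's) module_scheme \<Rightarrow> ('a, 'n, 't) module_scheme \<Rightarrow>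
      ('m \<Rightarrow> 'n) \<Rightarrow> bool"
  where "cyclically_pure_map U R M N v \<longleftrightarrow>
    (\<forall>P :: ('a, 'p) module. cyclic_module R P \<longrightarrow>
       inj_on (tensor_map R N P v id) (carrier (tensor R M P)))"


section \<open>Localization\<close>

text \<open>
  \<open>S\<close> is a multiplicative subset of \<open>R\<close>. Fractions \<open>x / s\<close> are equivalence classes of pairs, and operations
  on them are unions over representatives, as for \<^const>\<open>tensor_map\<close>. The ring \<open>S\<inverse>R\<close> consists of the
  fractions of \<open>R\<close> regarded as a module over itself.
\<close>

definition fraction_rel ::
    "('a, 'r) ring_scheme \<Rightarrow> 'a set \<Rightarrow> ('a, 'm, 's) module_scheme \<Rightarrow> (('m \<times> 'a) \<times> ('m \<times> 'a)) set"
  where "fraction_rel R S M =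
    {((x, s), (y, t)). x \<in> carrier M \<and> y \<in> carrier M \<and> s \<in> S \<and> t \<in> S \<and>
       (\<exists>u\<in>S. u \<odot>\<^bsub>M\<^esub> (t \<odot>\<^bsub>M\<^esub> x) = u \<odot>\<^bsub>M\<^esub> (s \<odot>\<^bsub>M\<^esub> y))}"

definition fraction ::
    "('a, 'r) ring_scheme \<Rightarrow> 'a set \<Rightarrow> ('a, 'm, 's) module_scheme \<Rightarrow> 'm \<Rightarrow> 'a \<Rightarrow> ('m \<times> 'a) set"
  where "fraction R S M x s = fraction_rel R S M `` {(x, s)}"

definition localized_ring :: "('a, 'r) ring_scheme \<Rightarrow> 'a set \<Rightarrow> ('a \<times> 'a) set ring"
  where "localized_ring R S =
    \<lparr>carrier = (carrier R \<times> S) // fraction_rel R S (self_module R),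
     mult = (\<lambda>X Y. \<Union>(a, s)\<in>X. \<Union>(b, t)\<in>Y. fraction R S (self_module R) (a \<otimes>\<^bsub>R\<^esub> b) (s \<otimes>\<^bsub>R\<^esub> t)),
     one = fraction R S (self_module R) \<one>\<^bsub>R\<^esub> \<one>\<^bsub>R\<^esub>,
     zero = fraction R S (self_module R) \<zero>\<^bsub>R\<^esub> \<one>\<^bsub>R\<^esub>,
     add = (\<lambda>X Y. \<Union>(a, s)\<in>X. \<Union>(b, t)\<in>Y.
       fraction R S (self_module R) (t \<otimes>\<^bsub>R\<^esub> a \<oplus>\<^bsub>R\<^esub> s \<otimes>\<^bsub>R\<^esub> b) (s \<otimes>\<^bsub>R\<^esub> t))\<rparr>"

text \<open>
  The record type of modules extends that of rings; the fields \<open>mult\<close> and \<open>one\<close> play no role for modules.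
\<close>

definition localized_module ::
    "('a, 'r) ring_scheme \<Rightarrow> 'a set \<Rightarrow> ('a, 'm, 's) module_scheme \<Rightarrow>
      (('a \<times> 'a) set, ('m \<times> 'a) set) module"
  where "localized_module R S M =
    \<lparr>carrier = (carrier M \<times> S) // fraction_rel R S M,
     mult = undefined,
     one = undefined,
     zero = fraction R S M \<zero>\<^bsub>M\<^esub> \<one>\<^bsub>R\<^esub>,
     add = (\<lambda>X Y. \<Union>(x, s)\<in>X. \<Union>(y, t)\<in>Y.
       fraction R S M (t \<odot>\<^bsub>M\<^esub> x \<oplus>\<^bsub>M\<^esub> s \<odot>\<^bsub>M\<^esub> y) (s \<otimes>\<^bsub>R\<^esub> t)),
     smult = (\<lambda>X Y. \<Union>(a, s)\<in>X. \<Union>(y, t)\<in>Y. fraction R S M (a \<odot>\<^bsub>M\<^esub> y) (s \<otimes>\<^bsub>R\<^esub> t))\<rparr>"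

definition localized_map ::
    "('a, 'r) ring_scheme \<Rightarrow> 'a set \<Rightarrow> ('a, 'n, 't) module_scheme \<Rightarrow> ('m \<Rightarrow> 'n) \<Rightarrow>
      ('m \<times> 'a) set \<Rightarrow> ('n \<times> 'a) set"
  where "localized_map R S N v X = (\<Union>(x, s)\<in>X. fraction R S N (v x) s)"


section \<open>Spectrum and pure loci\<close>

definition Spec :: "('a, 'r) ring_scheme \<Rightarrow> 'a set set"
  where "Spec R = {\<pp>. primeideal \<pp> R}"

definition vanishing_set :: "('a, 'r) ring_scheme \<Rightarrow> 'a set \<Rightarrow> 'a set set"
  where "vanishing_set R I = {\<pp> \<in> Spec R. I \<subseteq> \<pp>}"

definition Pure_locus ::
    "'p itself \<Rightarrow> ('a, 'r) ring_scheme \<Rightarrow> ('a, 'm, 's) module_scheme \<Rightarrow> ('a, 'n, 't) module_scheme \<Rightarrow>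
      ('m \<Rightarrow> 'n) \<Rightarrow> 'a set set"
  where "Pure_locus U R M N v =
    {\<pp> \<in> Spec R. let S = carrier R - \<pp> in
       pure_map U (localized_ring R S) (localized_module R S M) (localized_module R S N)
         (localized_map R S N v)}"

definition CPure_locus ::
    "'p itself \<Rightarrow> ('a, 'r) ring_scheme \<Rightarrow> ('a, 'm, 's) module_scheme \<Rightarrow> ('a, 'n, 't) module_scheme \<Rightarrow>
      ('m \<Rightarrow> 'n) \<Rightarrow> 'a set set"
  where "CPure_locus U R M N v =
    {\<pp> \<in> Spec R. let S = carrier R - \<pp> in
       cyclically_pure_map U (localized_ring R S) (localized_module R S M) (localized_module R S N)
         (localized_map R S N v)}"


section \<open>Content\<close>

definition ideal_smult :: "'a set \<Rightarrow> ('a, 'm, 's) module_scheme \<Rightarrow> 'm set"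
  where "ideal_smult I M =
    {\<Oplus>\<^bsub>M\<^esub>k\<in>{..<n}. a k \<odot>\<^bsub>M\<^esub> x k | (n :: nat) a x. a \<in> {..<n} \<rightarrow> I \<and> x \<in> {..<n} \<rightarrow> carrier M}"

definition module_content :: "('a, 'r) ring_scheme \<Rightarrow> ('a, 'm, 's) module_scheme \<Rightarrow> 'm \<Rightarrow> 'a set"
  where "module_content R M x = \<Inter>{I. ideal I R \<and> x \<in> ideal_smult I M}"

definition Ohm_Rush :: "('a, 'r) ring_scheme \<Rightarrow> ('a, 'm, 's) module_scheme \<Rightarrow> bool"
  where "Ohm_Rush R M \<longleftrightarrow> (\<forall>x\<in>carrier M. x \<in> ideal_smult (module_content R M x) M)"

end

theory Submission
  imports Defs
begin

text \<open>
  Write \<open>x = v 1\<close> and let \<open>c\<close> be the content of \<open>x\<close>. Identifying \<open>R \<otimes> P\<close> with \<open>P\<close>, the map \<open>v \<otimes> P\<close> becomes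
  \<open>y \<mapsto> x \<otimes> y\<close>. So \<open>v\<close> is pure if and only if \<open>x \<otimes> y = 0\<close> in \<open>M \<otimes> P\<close> implies \<open>y = 0\<close>, for all \<open>P\<close>
  (\<open>inj_on_tensor_map_from_ring_iff\<close>).

  Flatness controls these equations: if \<open>x \<otimes> y = 0\<close>, then \<open>x \<otimes> y\<close> vanishes already in \<open>M \<otimes> R y\<close>, which is
  \<open>M / I M\<close> for \<open>I\<close> the annihilator of \<open>y\<close>. Thus \<open>x \<in> I M\<close> and \<open>c \<subseteq> I\<close> (\<open>flat_annihilator\<close>). If \<open>c = R\<close>, it
  follows that \<open>y = 0\<close>, so \<open>v\<close> is pure. Conversely, if \<open>x \<in> I M\<close>, then \<open>x\<close> becomes zero in \<open>M \<otimes> R / I\<close>; testing purity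
  on \<open>R / I\<close> gives \<open>I = R\<close> (\<open>ideal_eq_carrier_if_cyclically_pure\<close>), so \<open>c = R\<close>. This proves (1).

  For (2), let \<open>p\<close> be a prime. Suppose \<open>c\<close> contains some \<open>s \<notin> p\<close>. For a module \<open>P\<close> over the localization, an equation
  \<open>x / 1 \<otimes> y = 0\<close> descends to \<open>x \<otimes> y = 0\<close> over \<open>R\<close> (\<open>kernel_restrict_scalars\<close>). Therefore \<open>s\<close> annihilates \<open>y\<close>, and \<open>y = 0\<close>
  because \<open>s\<close> acts invertibly on \<open>P\<close>; so the localized map is pure. If \<open>c \<subseteq> p\<close>, the Ohm-Rush property gives
  \<open>x \<in> c M \<subseteq> p M\<close>. Then \<open>x\<close> becomes zero after tensoring with the residue field at \<open>p\<close>, which is a cyclic module over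
  the localization, so the localized map is not even cyclically pure.
\<close>

section \<open>Equality in a tensor product\<close>

lemma tensor_relators_subset:
  assumes "module R M" "module R N"
  shows "tensor_relators R M N \<subseteq> carrier (free_Abelian_group (carrier M \<times> carrier N))"
proof -
  interpret M: module R M by fact
  interpret N: module R N by fact
  show ?thesis
    unfolding tensor_relators_def
    by (auto dest!: subsetD[OF keys_diff] simp: keys_frag_of)
qed

lemma tensor_kernel_subset:
  assumes "module R M" "module R N"
  shows "tensor_kernel R M N \<subseteq> carrier (free_Abelian_group (carrier M \<times> carrier N))"
  unfolding tensor_kernel_def
  by (rule group.generate_incl[OF group_free_Abelian_group tensor_relators_subset[OF assms]])

lemma tensor_kernel_keys:
  assumes "module R M" "module R N" "c \<in> tensor_kernel R M N"
  shows "Poly_Mapping.keys c \<subseteq> carrier M \<times> carrier N"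
  using subsetD[OF tensor_kernel_subset[OF assms(1,2)] assms(3)] by simp

lemma subgroup_tensor_kernel:
  assumes "module R M" "module R N"
  shows "subgroup (tensor_kernel R M N) (free_Abelian_group (carrier M \<times> carrier N))"
  unfolding tensor_kernel_def
  by (rule group.generate_is_subgroup[OF group_free_Abelian_group tensor_relators_subset[OF assms]])

text \<open>
  \<^const>\<open>tensor_kernel\<close> is generated with the inverse of \<^const>\<open>free_Abelian_group\<close>, which equals \<open>uminus\<close> only on
  formal sums supported in the carriers. The rule absorbs this side condition, so that consequences of the
  three bilinearity relations can be propagated in the ambient type of formal sums.
\<close>

lemma tensor_kernel_induct [consumes 3, case_names zero add_left add_right balanced uminus add]:
  assumes M: "module R M" and N: "module R N" and c: "c \<in> tensor_kernel R M N"
    and "P 0"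
    and "\<And>x x' y. \<lbrakk>x \<in> carrier M; x' \<in> carrier M; y \<in> carrier N\<rbrakk> \<Longrightarrow>
           P (frag_of (x \<oplus>\<^bsub>M\<^esub> x', y) - frag_of (x, y) - frag_of (x', y))"
    and "\<And>x y y'. \<lbrakk>x \<in> carrier M; y \<in> carrier N; y' \<in> carrier N\<rbrakk> \<Longrightarrow>
           P (frag_of (x, y \<oplus>\<^bsub>N\<^esub> y') - frag_of (x, y) - frag_of (x, y'))"
    and "\<And>r x y. \<lbrakk>r \<in> carrier R; x \<in> carrier M; y \<in> carrier N\<rbrakk> \<Longrightarrow>
           P (frag_of (r \<odot>\<^bsub>M\<^esub> x, y) - frag_of (x, r \<odot>\<^bsub>N\<^esub> y))"
    and uminus: "\<And>c. \<lbrakk>c \<in> tensor_kernel R M N; P c\<rbrakk> \<Longrightarrow> P (- c)"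
    and add: "\<And>c d. \<lbrakk>c \<in> tensor_kernel R M N; d \<in> tensor_kernel R M N; P c; P d\<rbrakk> \<Longrightarrow> P (c + d)"
  shows "P c"
proof -
  have relator: "P h" if "h \<in> tensor_relators R M N" for h
    using that assms(5-7) unfolding tensor_relators_def by auto
  show ?thesis using c unfolding tensor_kernel_def
  proof (induction rule: generate.induct)
    case (inv h)
    then have "Poly_Mapping.keys h \<subseteq> carrier M \<times> carrier N"
      using subsetD[OF tensor_relators_subset[OF M N]] by simp
    moreover have "h \<in> tensor_kernel R M N"
      using inv by (simp add: tensor_kernel_def generate.incl)
    ultimately show ?case using relator[OF inv] uminus by simp
  qed (use relator add \<open>P 0\<close> in \<open>auto simp: tensor_kernel_def\<close>)
qed

locale module_pair = M: module R M + N: module R N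
  for R :: "('a, 'r) ring_scheme" and M :: "('a, 'm, 's) module_scheme"
    and N :: "('a, 'n, 't) module_scheme"
begin

abbreviation K where "K \<equiv> tensor_kernel R M N"
abbreviation F where "F \<equiv> free_Abelian_group (carrier M \<times> carrier N)"

lemma modules [simp]: "module R M" "module R N" by unfold_locales

lemma kernel_keys: "c \<in> K \<Longrightarrow> Poly_Mapping.keys c \<subseteq> carrier M \<times> carrier N"
  by (rule tensor_kernel_keys) simp_all

lemma kernel_zero [simp]: "0 \<in> K"
  using subgroup.one_closed[OF subgroup_tensor_kernel[of R M N]] by simp

lemma kernel_add: "c \<in> K \<Longrightarrow> d \<in> K \<Longrightarrow> c + d \<in> K"
  using subgroup.m_closed[OF subgroup_tensor_kernel[of R M N]] by simp

lemma kernel_uminus: "c \<in> K \<Longrightarrow> - c \<in> K"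
  using subgroup.m_inv_closed[OF subgroup_tensor_kernel[of R M N], of c] kernel_keys[of c] by simp

lemma kernel_diff: "c \<in> K \<Longrightarrow> d \<in> K \<Longrightarrow> c - d \<in> K"
  using kernel_add[of c "- d"] kernel_uminus[of d] by simp

text \<open>
  Equality in \<open>M \<otimes> N\<close>, expressed on representatives: computing with elementary tensors modulo \<open>K\<close> inside the
  additive type of formal sums is much lighter than computing with cosets.
\<close>

definition teq (infix "\<equiv>\<^sub>K" 50) where "c \<equiv>\<^sub>K d \<longleftrightarrow> c - d \<in> K"

lemma teq_refl [simp]: "c \<equiv>\<^sub>K c" by (simp add: teq_def)

lemma teq_sym: "c \<equiv>\<^sub>K d \<Longrightarrow> d \<equiv>\<^sub>K c"
  using kernel_uminus[of "c - d"] by (simp add: teq_def)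

lemma teq_trans [trans]: "c \<equiv>\<^sub>K d \<Longrightarrow> d \<equiv>\<^sub>K e \<Longrightarrow> c \<equiv>\<^sub>K e"
  using kernel_add[of "c - d" "d - e"] by (simp add: teq_def)

lemma teq_add: "c \<equiv>\<^sub>K d \<Longrightarrow> c' \<equiv>\<^sub>K d' \<Longrightarrow> c + c' \<equiv>\<^sub>K d + d'"
  using kernel_add[of "c - d" "c' - d'"] by (simp add: teq_def algebra_simps)

lemma teq_diff: "c \<equiv>\<^sub>K d \<Longrightarrow> c' \<equiv>\<^sub>K d' \<Longrightarrow> c - c' \<equiv>\<^sub>K d - d'"
  using kernel_diff[of "c - d" "c' - d'"] by (simp add: teq_def algebra_simps)

lemma kernel_iff_teq: "c \<in> K \<longleftrightarrow> c \<equiv>\<^sub>K 0"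
  by (simp add: teq_def)

lemma kernel_cong: "c \<equiv>\<^sub>K d \<Longrightarrow> c \<in> K \<longleftrightarrow> d \<in> K"
  using teq_trans teq_sym kernel_iff_teq by blast

lemma teq_add_left:
  "\<lbrakk>x \<in> carrier M; x' \<in> carrier M; y \<in> carrier N\<rbrakk> \<Longrightarrow>
     frag_of (x \<oplus>\<^bsub>M\<^esub> x', y) \<equiv>\<^sub>K frag_of (x, y) + frag_of (x', y)"
  unfolding teq_def diff_diff_eq[symmetric] tensor_kernel_def
  by (rule generate.incl) (auto simp: tensor_relators_def)

lemma teq_add_right:
  "\<lbrakk>x \<in> carrier M; y \<in> carrier N; y' \<in> carrier N\<rbrakk> \<Longrightarrow>
     frag_of (x, y \<oplus>\<^bsub>N\<^esub> y') \<equiv>\<^sub>K frag_of (x, y) + frag_of (x, y')"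
  unfolding teq_def diff_diff_eq[symmetric] tensor_kernel_def
  by (rule generate.incl) (auto simp: tensor_relators_def)

lemma teq_balanced:
  "\<lbrakk>r \<in> carrier R; x \<in> carrier M; y \<in> carrier N\<rbrakk> \<Longrightarrow>
     frag_of (r \<odot>\<^bsub>M\<^esub> x, y) \<equiv>\<^sub>K frag_of (x, r \<odot>\<^bsub>N\<^esub> y)"
  unfolding teq_def tensor_kernel_def
  by (rule generate.incl) (auto simp: tensor_relators_def)

lemma zero_right_in_kernel: "x \<in> carrier M \<Longrightarrow> frag_of (x, \<zero>\<^bsub>N\<^esub>) \<in> K"
  using teq_add_right[of x "\<zero>\<^bsub>N\<^esub>" "\<zero>\<^bsub>N\<^esub>"] kernel_uminus[of "- frag_of (x, \<zero>\<^bsub>N\<^esub>)"]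
  by (simp add: teq_def)

lemma zero_left_in_kernel: "y \<in> carrier N \<Longrightarrow> frag_of (\<zero>\<^bsub>M\<^esub>, y) \<in> K"
  using teq_add_left[of "\<zero>\<^bsub>M\<^esub>" "\<zero>\<^bsub>M\<^esub>" y] kernel_uminus[of "- frag_of (\<zero>\<^bsub>M\<^esub>, y)"]
  by (simp add: teq_def)

lemma teq_minus_right:
  assumes "x \<in> carrier M" "y \<in> carrier N" "y' \<in> carrier N"
  shows "frag_of (x, y \<ominus>\<^bsub>N\<^esub> y') \<equiv>\<^sub>K frag_of (x, y) - frag_of (x, y')"
proof -
  have "y = (y \<ominus>\<^bsub>N\<^esub> y') \<oplus>\<^bsub>N\<^esub> y'"
    using assms by (simp add: N.minus_eq N.a_assoc N.l_neg)
  then have "frag_of (x, y) \<equiv>\<^sub>K frag_of (x, y \<ominus>\<^bsub>N\<^esub> y') + frag_of (x, y')"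
    using teq_add_right[of x "y \<ominus>\<^bsub>N\<^esub> y'" y'] assms by simp
  from teq_sym[OF teq_diff[OF this teq_refl[of "frag_of (x, y')"]]] show ?thesis by simp
qed

lemma mem_tensor_class_iff: "d \<in> tensor_class R M N c \<longleftrightarrow> d \<equiv>\<^sub>K c"
  by (auto simp: tensor_class_def r_coset_def teq_def intro: bexI[of _ "d - c"])

lemma tensor_class_eq_iff: "tensor_class R M N c = tensor_class R M N d \<longleftrightarrow> c \<equiv>\<^sub>K d"
proof -
  have "tensor_class R M N c = tensor_class R M N d \<longleftrightarrow> (\<forall>e. e \<equiv>\<^sub>K c \<longleftrightarrow> e \<equiv>\<^sub>K d)"
    by (simp add: set_eq_iff mem_tensor_class_iff)
  also have "\<dots> \<longleftrightarrow> c \<equiv>\<^sub>K d" using teq_refl teq_sym teq_trans by blast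
  finally show ?thesis .
qed

lemma carrier_tensor: "carrier (tensor R M N) = tensor_class R M N ` carrier F"
  by (auto simp: tensor_def FactGroup_def RCOSETS_def tensor_class_def)

text \<open>
  The universal property of \<open>M \<otimes> N\<close> for a target of the form \<open>F / L\<close>, where \<open>F\<close> consists of formal sums. The map
  \<open>b\<close> need only be bilinear modulo \<open>L\<close>; hence the target can be another tensor product, and \<open>b\<close> may be defined
  by choosing representatives.
\<close>

lemma kernel_frag_extend:
  assumes "0 \<in> L" and uminus: "\<And>c. c \<in> L \<Longrightarrow> - c \<in> L" and add: "\<And>c d. c \<in> L \<Longrightarrow> d \<in> L \<Longrightarrow> c + d \<in> L"
    and "\<And>x x' y. \<lbrakk>x \<in> carrier M; x' \<in> carrier M; y \<in> carrier N\<rbrakk> \<Longrightarrow>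
           b (x \<oplus>\<^bsub>M\<^esub> x', y) - (b (x, y) + b (x', y)) \<in> L"
    and "\<And>x y y'. \<lbrakk>x \<in> carrier M; y \<in> carrier N; y' \<in> carrier N\<rbrakk> \<Longrightarrow>
           b (x, y \<oplus>\<^bsub>N\<^esub> y') - (b (x, y) + b (x, y')) \<in> L"
    and "\<And>r x y. \<lbrakk>r \<in> carrier R; x \<in> carrier M; y \<in> carrier N\<rbrakk> \<Longrightarrow>
           b (r \<odot>\<^bsub>M\<^esub> x, y) - b (x, r \<odot>\<^bsub>N\<^esub> y) \<in> L"
    and c: "c \<in> K"
  shows "frag_extend b c \<in> L"
  using modules c
  by (induction rule: tensor_kernel_induct)
     (use assms in \<open>simp_all add: frag_extend_diff frag_extend_minus frag_extend_add diff_diff_eq\<close>)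

text \<open>
  The same universal property for a target \<open>Q / H\<close> with \<open>H\<close> a subgroup of an abelian group \<open>Q\<close>. Bilinearity modulo
  \<open>H\<close> replaces the construction of the quotient group.
\<close>

lemma kernel_additive_target:
  assumes Q: "abelian_group Q" and H: "subgroup H (add_monoid Q)"
    and b: "\<And>x y. \<lbrakk>x \<in> carrier M; y \<in> carrier N\<rbrakk> \<Longrightarrow> b (x, y) \<in> carrier Q"
    and b_add_left: "\<And>x x' y. \<lbrakk>x \<in> carrier M; x' \<in> carrier M; y \<in> carrier N\<rbrakk> \<Longrightarrow>
           b (x \<oplus>\<^bsub>M\<^esub> x', y) \<ominus>\<^bsub>Q\<^esub> b (x, y) \<ominus>\<^bsub>Q\<^esub> b (x', y) \<in> H"
    and b_add_right: "\<And>x y y'. \<lbrakk>x \<in> carrier M; y \<in> carrier N; y' \<in> carrier N\<rbrakk> \<Longrightarrow>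
           b (x, y \<oplus>\<^bsub>N\<^esub> y') \<ominus>\<^bsub>Q\<^esub> b (x, y) \<ominus>\<^bsub>Q\<^esub> b (x, y') \<in> H"
    and b_balanced: "\<And>r x y. \<lbrakk>r \<in> carrier R; x \<in> carrier M; y \<in> carrier N\<rbrakk> \<Longrightarrow>
           b (r \<odot>\<^bsub>M\<^esub> x, y) \<ominus>\<^bsub>Q\<^esub> b (x, r \<odot>\<^bsub>N\<^esub> y) \<in> H"
    and xy: "x \<in> carrier M" "y \<in> carrier N" "frag_of (x, y) \<in> K"
  shows "b (x, y) \<in> H"
proof -
  interpret Q: abelian_group Q by fact
  interpret H: subgroup H "add_monoid Q" by fact
  (* Extend b additively to all formal sums; the relators land in H, hence so does the kernel. *)
  obtain h where h: "h \<in> hom F (add_monoid Q)"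
    and h_of: "\<And>z. z \<in> carrier M \<times> carrier N \<Longrightarrow> h (frag_of z) = b z"
    using comm_group.free_Abelian_group_universal[OF Q.a_comm_group, of b "carrier M \<times> carrier N"] b by (auto simp: image_subset_iff)
  interpret h: group_hom F "add_monoid Q" h
    using h by (simp add: group_hom_def group_hom_axioms_def Q.add.is_group)
  have h_closed: "h c \<in> carrier Q" if "Poly_Mapping.keys c \<subseteq> carrier M \<times> carrier N" for c
    using h.hom_closed[of c] that by simp
  have h_add: "h (c + d) = h c \<oplus>\<^bsub>Q\<^esub> h d"
    if "Poly_Mapping.keys c \<subseteq> carrier M \<times> carrier N" "Poly_Mapping.keys d \<subseteq> carrier M \<times> carrier N" for c d
    using h.hom_mult[of c d] that by simp
  have h_uminus: "h (- c) = \<ominus>\<^bsub>Q\<^esub> h c" if "Poly_Mapping.keys c \<subseteq> carrier M \<times> carrier N" for c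
    using h.hom_inv[of c] that by (simp add: a_inv_def)
  have h_diff: "h (c - d) = h c \<ominus>\<^bsub>Q\<^esub> h d"
    if "Poly_Mapping.keys c \<subseteq> carrier M \<times> carrier N" "Poly_Mapping.keys d \<subseteq> carrier M \<times> carrier N" for c d
    using h_add[of c "- d"] h_uminus[of d] that by (simp add: Q.minus_eq)
  have kd: "Poly_Mapping.keys (c - d) \<subseteq> S" if "Poly_Mapping.keys c \<subseteq> S" "Poly_Mapping.keys d \<subseteq> S"
    for c d :: "'m \<times> 'n \<Rightarrow>\<^sub>0 int" and S
    using keys_diff[of c d] that by blast
  have "h c \<in> H" if "c \<in> K" for c
    using modules that
  proof (induction rule: tensor_kernel_induct)
    case zero
    show ?case using h.hom_one H.one_closed by simp
  next
    case (uminus c)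
    then show ?case using H.m_inv_closed[of "h c"] by (simp add: h_uminus kernel_keys a_inv_def)
  next
    case (add c d)
    then show ?case using H.m_closed[of "h c" "h d"] by (simp add: h_add kernel_keys)
  qed (simp_all add: h_diff h_of kd b_add_left b_add_right b_balanced)
  with xy h_of[of "(x, y)"] show ?thesis by force
qed

end

lemma module_pairI: "module R M \<Longrightarrow> module R N \<Longrightarrow> module_pair R M N"
  by (simp add: module_pair_def)

lemma tensor_kernel_map:
  assumes MN: "module_pair R M N" and MN': "module_pair R M' N'"
    and f: "f \<in> linear_maps R M M'" and g: "g \<in> linear_maps R N N'"
    and c: "c \<in> tensor_kernel R M N"
  shows "frag_extend (\<lambda>(x, y). frag_of (f x, g y)) c \<in> tensor_kernel R M' N'"
proof -
  interpret A: module_pair R M N by fact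
  interpret B: module_pair R M' N' by fact
  let ?b = "\<lambda>(x, y). frag_of (f x, g y)"
  have fc: "\<And>x. x \<in> carrier M \<Longrightarrow> f x \<in> carrier M'"
    and gc: "\<And>x. x \<in> carrier N \<Longrightarrow> g x \<in> carrier N'"
    using f g by (auto simp: linear_maps_def)
  show ?thesis
  proof (rule A.kernel_frag_extend[OF _ _ _ _ _ _ c])
    fix x x' y assume "x \<in> carrier M" "x' \<in> carrier M" "y \<in> carrier N"
    then show "?b (x \<oplus>\<^bsub>M\<^esub> x', y) - (?b (x, y) + ?b (x', y)) \<in> B.K"
      using B.teq_add_left[of "f x" "f x'" "g y"] f by (simp add: fc gc linear_maps_def B.teq_def)
  next
    fix x y y' assume "x \<in> carrier M" "y \<in> carrier N" "y' \<in> carrier N"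
    then show "?b (x, y \<oplus>\<^bsub>N\<^esub> y') - (?b (x, y) + ?b (x, y')) \<in> B.K"
      using B.teq_add_right[of "f x" "g y" "g y'"] g by (simp add: fc gc linear_maps_def B.teq_def)
  next
    fix r x y assume "r \<in> carrier R" "x \<in> carrier M" "y \<in> carrier N"
    then show "?b (r \<odot>\<^bsub>M\<^esub> x, y) - ?b (x, r \<odot>\<^bsub>N\<^esub> y) \<in> B.K"
      using B.teq_balanced[of r "f x" "g y"] f g by (simp add: fc gc linear_maps_def B.teq_def)
  qed (auto intro: B.kernel_add B.kernel_uminus)
qed

text \<open>
  Since \<open>f \<otimes> g\<close> sends the class of \<open>c\<close> to the class of the image of \<open>c\<close>, it is injective exactly if only formal
  sums that are already zero in \<open>M \<otimes> N\<close> become zero in \<open>M' \<otimes> N'\<close>.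
\<close>

lemma inj_on_tensor_map_iff:
  assumes MN: "module_pair R M N" and MN': "module_pair R M' N'"
    and f: "f \<in> linear_maps R M M'" and g: "g \<in> linear_maps R N N'"
  shows "inj_on (tensor_map R M' N' f g) (carrier (tensor R M N)) \<longleftrightarrow>
    (\<forall>c. Poly_Mapping.keys c \<subseteq> carrier M \<times> carrier N \<longrightarrow>
       frag_extend (\<lambda>(x, y). frag_of (f x, g y)) c \<in> tensor_kernel R M' N' \<longrightarrow>
       c \<in> tensor_kernel R M N)"
proof -
  interpret A: module_pair R M N by fact
  interpret B: module_pair R M' N' by fact
  let ?b = "\<lambda>(x, y). frag_of (f x, g y)"
  let ?E = "frag_extend ?b"
  have fc: "\<And>x. x \<in> carrier M \<Longrightarrow> f x \<in> carrier M'"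
    and gc: "\<And>x. x \<in> carrier N \<Longrightarrow> g x \<in> carrier N'"
    using f g by (auto simp: linear_maps_def)
  have E_kernel: "?E c \<in> tensor_kernel R M' N'" if "c \<in> tensor_kernel R M N" for c
    using tensor_kernel_map[OF MN MN' f g that] .
  have E_carrier: "Poly_Mapping.keys (?E c) \<subseteq> carrier M' \<times> carrier N'"
    if "Poly_Mapping.keys c \<subseteq> carrier M \<times> carrier N" for c
    using keys_frag_extend[of ?b c] that by (fastforce simp: keys_frag_of fc gc)
  have map_class: "tensor_map R M' N' f g (tensor_class R M N c) = tensor_class R M' N' (?E c)"
    if c: "Poly_Mapping.keys c \<subseteq> carrier M \<times> carrier N" for c
  proof -
    have eq: "tensor_class R M' N' (?E d) = tensor_class R M' N' (?E c)" if "d \<in> tensor_class R M N c" for d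
    proof -
      have "d - c \<in> A.K" using that by (simp add: A.mem_tensor_class_iff A.teq_def)
      moreover from A.kernel_keys[OF this] c have "Poly_Mapping.keys d \<subseteq> carrier M \<times> carrier N"
        using keys_add[of "d - c" c] by auto
      ultimately show ?thesis
        using E_kernel[of "d - c"] c
        by (simp add: B.tensor_class_eq_iff E_carrier B.teq_def frag_extend_diff)
    qed
    moreover have "c \<in> tensor_class R M N c" by (simp add: A.mem_tensor_class_iff)
    ultimately show ?thesis unfolding tensor_map_def by blast
  qed
  show ?thesis (is "?inj \<longleftrightarrow> ?ker")
  proof
    assume inj: ?inj
    show ?ker
    proof (intro allI impI)
      fix c assume c: "Poly_Mapping.keys c \<subseteq> carrier M \<times> carrier N" "?E c \<in> B.K"
      have "tensor_class R M' N' (?E c) = tensor_class R M' N' (?E 0)"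
        using c E_carrier[OF c(1)] by (simp add: B.tensor_class_eq_iff B.teq_def)
      then have "tensor_class R M N c = tensor_class R M N 0"
        using c(1) by (intro inj_onD[OF inj]) (auto simp: map_class A.carrier_tensor)
      then show "c \<in> A.K" using c(1) by (simp add: A.tensor_class_eq_iff A.teq_def)
    qed
  next
    assume ker: ?ker
    show ?inj
    proof (rule inj_onI, unfold A.carrier_tensor, elim imageE)
      fix X Y c d
      assume eq: "tensor_map R M' N' f g X = tensor_map R M' N' f g Y"
        and X: "X = tensor_class R M N c" "c \<in> carrier A.F" and Y: "Y = tensor_class R M N d" "d \<in> carrier A.F"
      have "?E (c - d) \<in> B.K"
        using eq X Y by (simp add: map_class B.tensor_class_eq_iff E_carrier B.teq_def frag_extend_diff)
      moreover have "Poly_Mapping.keys (c - d) \<subseteq> carrier M \<times> carrier N"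
        using keys_diff[of c d] X Y by auto
      ultimately have "c - d \<in> A.K" using ker by blast
      then show "X = Y" using X Y by (simp add: A.tensor_class_eq_iff A.teq_def)
    qed
  qed
qed


section \<open>Annihilators and products of an ideal with a module\<close>

lemma (in abelian_group) add_minus_cancel_both:
  assumes "a \<in> carrier G" "b \<in> carrier G"
  shows "a \<oplus> b \<ominus> a \<ominus> b = \<zero>"
proof -
  have "a \<oplus> b \<ominus> a = b \<oplus> (a \<oplus> \<ominus> a)"
    unfolding minus_eq a_comm[OF assms] using assms by (intro a_assoc) auto
  with assms show ?thesis by (simp add: minus_eq r_neg)
qed

context module
begin

definition annihilator where "annihilator y = {r \<in> carrier R. r \<odot>\<^bsub>M\<^esub> y = \<zero>\<^bsub>M\<^esub>}"

lemma annihilator_ideal: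
  assumes y: "y \<in> carrier M"
  shows "ideal (annihilator y) R"
proof (rule idealI)
  show "subgroup (annihilator y) (add_monoid R)"
    using y by (intro R.add.subgroupI)
       (auto simp: annihilator_def smult_l_distr smult_l_minus a_inv_def[symmetric] intro!: exI[of _ "\<zero>\<^bsub>R\<^esub>"])
next
  fix a r assume "a \<in> annihilator y" "r \<in> carrier R"
  then show "r \<otimes> a \<in> annihilator y" "a \<otimes> r \<in> annihilator y"
    using y by (simp_all add: annihilator_def smult_assoc1 R.m_comm[of a r])
qed (rule R.ring_axioms)

lemma annihilatorD: "r \<in> annihilator y \<Longrightarrow> r \<odot>\<^bsub>M\<^esub> y = \<zero>\<^bsub>M\<^esub>"
  by (simp add: annihilator_def)

text \<open>
  Building a finite sum by adding one product at a time: membership proofs can then avoid index sets and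
  \<^const>\<open>finsum\<close>.
\<close>

lemma ideal_smult_induct [consumes 2, case_names zero add_smult]:
  assumes I: "I \<subseteq> carrier R" and x: "x \<in> ideal_smult I M"
    and zero: "P \<zero>\<^bsub>M\<^esub>"
    and add: "\<And>y a m. \<lbrakk>y \<in> carrier M; P y; a \<in> I; m \<in> carrier M\<rbrakk> \<Longrightarrow> P (y \<oplus>\<^bsub>M\<^esub> a \<odot>\<^bsub>M\<^esub> m)"
  shows "P x"
proof -
  have "P (\<Oplus>\<^bsub>M\<^esub>k\<in>{..<n}. a k \<odot>\<^bsub>M\<^esub> m k)"
    if "a \<in> {..<n} \<rightarrow> I" "m \<in> {..<n} \<rightarrow> carrier M" for n :: nat and a m
    using that
  proof (induction n)
    case 0
    then show ?case using zero by simp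
  next
    case (Suc n)
    have am: "(\<lambda>k. a k \<odot>\<^bsub>M\<^esub> m k) \<in> {..<n} \<rightarrow> carrier M" and n: "a n \<in> I" "m n \<in> carrier M"
      using Suc.prems I by (auto simp: Pi_iff subset_iff)
    have "P (\<Oplus>\<^bsub>M\<^esub>k\<in>{..<n}. a k \<odot>\<^bsub>M\<^esub> m k)"
      using Suc.prems by (intro Suc.IH) (auto simp: Pi_iff)
    from add[OF _ this n] am n I
    show ?case by (simp add: lessThan_Suc M.finsum_insert M.a_comm subset_iff)
  qed
  with x show ?thesis by (auto simp: ideal_smult_def)
qed

lemma ideal_smult_carrier:
  assumes "I \<subseteq> carrier R" "x \<in> ideal_smult I M"
  shows "x \<in> carrier M"
  using assms by (induction rule: ideal_smult_induct) (auto dest: subsetD[OF assms(1)])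

lemma zero_in_ideal_smult [simp]: "\<zero>\<^bsub>M\<^esub> \<in> ideal_smult I M"
  unfolding ideal_smult_def by (auto intro!: exI[of _ "0::nat"])

lemma ideal_smult_add_smult:
  assumes I: "I \<subseteq> carrier R" and y: "y \<in> ideal_smult I M" and b: "b \<in> I" and z: "z \<in> carrier M"
  shows "y \<oplus>\<^bsub>M\<^esub> b \<odot>\<^bsub>M\<^esub> z \<in> ideal_smult I M"
proof -
  obtain n :: nat and a m where a: "a \<in> {..<n} \<rightarrow> I" and m: "m \<in> {..<n} \<rightarrow> carrier M"
    and y: "y = (\<Oplus>\<^bsub>M\<^esub>k\<in>{..<n}. a k \<odot>\<^bsub>M\<^esub> m k)"
    using y unfolding ideal_smult_def by blast
  let ?a = "a(n := b)" and ?m = "m(n := z)"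
  have am: "(\<lambda>k. a k \<odot>\<^bsub>M\<^esub> m k) \<in> {..<n} \<rightarrow> carrier M" using a m I by auto
  have "(\<Oplus>\<^bsub>M\<^esub>k\<in>{..<n}. ?a k \<odot>\<^bsub>M\<^esub> ?m k) = y"
    unfolding y using am by (intro M.finsum_cong') auto
  moreover have "(\<lambda>k. ?a k \<odot>\<^bsub>M\<^esub> ?m k) \<in> {..<n} \<rightarrow> carrier M" using am by auto
  ultimately have "(\<Oplus>\<^bsub>M\<^esub>k\<in>{..<Suc n}. ?a k \<odot>\<^bsub>M\<^esub> ?m k) = b \<odot>\<^bsub>M\<^esub> z \<oplus>\<^bsub>M\<^esub> y"
    using b z I by (simp add: lessThan_Suc M.finsum_insert subset_iff del: fun_upd_apply) simp
  moreover have "y \<in> carrier M" using y am by simp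
  ultimately have "y \<oplus>\<^bsub>M\<^esub> b \<odot>\<^bsub>M\<^esub> z = (\<Oplus>\<^bsub>M\<^esub>k\<in>{..<Suc n}. ?a k \<odot>\<^bsub>M\<^esub> ?m k)"
    using b z I by (simp add: M.a_comm subset_iff)
  moreover have "?a \<in> {..<Suc n} \<rightarrow> I" "?m \<in> {..<Suc n} \<rightarrow> carrier M"
    using a m b z by (auto simp: less_Suc_eq)
  ultimately show ?thesis unfolding ideal_smult_def by blast
qed

lemma smult_in_ideal_smult:
  assumes "I \<subseteq> carrier R" "a \<in> I" "m \<in> carrier M"
  shows "a \<odot>\<^bsub>M\<^esub> m \<in> ideal_smult I M"
  using ideal_smult_add_smult[OF assms(1) zero_in_ideal_smult assms(2,3)] assms by (simp add: subset_iff)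

lemma ideal_smult_add:
  assumes I: "I \<subseteq> carrier R" and x: "x \<in> ideal_smult I M" and y: "y \<in> ideal_smult I M"
  shows "x \<oplus>\<^bsub>M\<^esub> y \<in> ideal_smult I M"
  using I y
proof (induction rule: ideal_smult_induct)
  case zero
  then show ?case using x ideal_smult_carrier[OF I] by simp
next
  case (add_smult y a m)
  then show ?case
    using ideal_smult_add_smult[OF I, of "x \<oplus>\<^bsub>M\<^esub> y" a m] ideal_smult_carrier[OF I x] I
    by (simp add: M.a_assoc subset_iff)
qed

lemma ideal_smult_subgroup:
  assumes "ideal I R"
  shows "subgroup (ideal_smult I M) (add_monoid M)"
proof -
  interpret I: ideal I R by fact
  have I: "I \<subseteq> carrier R" by (rule I.a_subset)
  have "\<ominus>\<^bsub>M\<^esub> x \<in> ideal_smult I M" if "x \<in> ideal_smult I M" for x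
    using I that
  proof (induction rule: ideal_smult_induct)
    case zero
    then show ?case using M.add.inv_one by (simp add: a_inv_def)
  next
    case (add_smult y a m)
    then show ?case
      using ideal_smult_add_smult[OF I, of "\<ominus>\<^bsub>M\<^esub> y" "\<ominus> a" m] I
      by (simp add: M.minus_add smult_l_minus subset_iff)
  qed
  then show ?thesis
    using I by (intro M.add.subgroupI)
       (auto simp: ideal_smult_add a_inv_def[symmetric] ideal_smult_carrier intro: zero_in_ideal_smult)
qed

end

section \<open>Tensor products with the base ring\<close>

lemma self_module_simps [simp]:
  "carrier (self_module R) = carrier R" "add (self_module R) = add R"
  "smult (self_module R) = mult R" "zero (self_module R) = \<zero>\<^bsub>R\<^esub>"
  by (simp_all add: self_module_def)

lemma module_self_module:
  assumes "cring R"
  shows "module R (self_module R)"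
proof -
  interpret cring R by fact
  have "abelian_group (self_module R)"
    by (rule abelian_groupI) (auto simp: a_assoc intro: a_comm l_neg)
  with assms show ?thesis
    by (intro moduleI) (auto simp: l_distr r_distr m_assoc)
qed

text \<open>
  If \<open>x\<close> is the sum of \<open>a\<^sub>k m\<^sub>k\<close>, then \<open>x \<otimes> y\<close> is the sum of \<open>m\<^sub>k \<otimes> a\<^sub>k y\<close>, and every \<open>a\<^sub>k y\<close> vanishes.
\<close>

lemma (in module_pair) smult_in_kernel_if_annihilated:
  assumes I: "I \<subseteq> carrier R" and x: "x \<in> ideal_smult I M" and y: "y \<in> carrier N"
    and ann: "\<And>a. a \<in> I \<Longrightarrow> a \<odot>\<^bsub>N\<^esub> y = \<zero>\<^bsub>N\<^esub>"
  shows "frag_of (x, y) \<in> K"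
  using I x
proof (induction rule: M.ideal_smult_induct)
  case zero
  show ?case using y by (rule zero_left_in_kernel)
next
  case (add_smult z a m)
  have a: "a \<in> carrier R" using add_smult I by auto
  have "frag_of (a \<odot>\<^bsub>M\<^esub> m, y) \<equiv>\<^sub>K frag_of (m, \<zero>\<^bsub>N\<^esub>)"
    using teq_balanced[OF a \<open>m \<in> carrier M\<close> y] ann[OF \<open>a \<in> I\<close>] by simp
  then have "frag_of (a \<odot>\<^bsub>M\<^esub> m, y) \<in> K"
    using zero_right_in_kernel[OF \<open>m \<in> carrier M\<close>] kernel_cong by blast
  moreover have "frag_of (z \<oplus>\<^bsub>M\<^esub> a \<odot>\<^bsub>M\<^esub> m, y) \<equiv>\<^sub>K frag_of (z, y) + frag_of (a \<odot>\<^bsub>M\<^esub> m, y)"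
    using add_smult a y by (intro teq_add_left) auto
  ultimately show ?case using kernel_cong kernel_add add_smult by blast
qed

text \<open>
  The multiplication map from \<open>R \<otimes> P\<close> to \<open>P\<close> is well defined and sends \<open>1 \<otimes> y\<close> to \<open>y\<close>.
\<close>

lemma self_module_kernel:
  assumes P: "module R P" and y: "y \<in> carrier P"
    and k: "frag_of (\<one>\<^bsub>R\<^esub>, y) \<in> tensor_kernel R (self_module R) P"
  shows "y = \<zero>\<^bsub>P\<^esub>"
proof -
  interpret P: module R P by fact
  interpret module_pair R "self_module R" P
    by (intro module_pairI module_self_module P P.R.is_cring)
  have "(case (\<one>\<^bsub>R\<^esub>, y) of (r, z) \<Rightarrow> r \<odot>\<^bsub>P\<^esub> z) \<in> {\<zero>\<^bsub>P\<^esub>}"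
  proof (rule kernel_additive_target[OF P.abelian_group_axioms, where b = "\<lambda>(r, z). r \<odot>\<^bsub>P\<^esub> z"])
    show "subgroup {\<zero>\<^bsub>P\<^esub>} (add_monoid P)"
      using P.add.triv_subgroup by simp
  next
    fix r a z assume "r \<in> carrier R" "a \<in> carrier (self_module R)" "z \<in> carrier P"
    then show "(case (r \<odot>\<^bsub>self_module R\<^esub> a, z) of (r, z) \<Rightarrow> r \<odot>\<^bsub>P\<^esub> z) \<ominus>\<^bsub>P\<^esub>
        (case (a, r \<odot>\<^bsub>P\<^esub> z) of (r, z) \<Rightarrow> r \<odot>\<^bsub>P\<^esub> z) \<in> {\<zero>\<^bsub>P\<^esub>}"
      by (simp add: P.smult_assoc1[symmetric] P.R.m_comm P.M.minus_eq P.M.r_neg)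
  qed (use k y in \<open>simp_all add: P.smult_l_distr P.smult_r_distr P.M.add_minus_cancel_both\<close>)
  with y show ?thesis by simp
qed

text \<open>
  Every tensor in \<open>R \<otimes> P\<close> equals some \<open>1 \<otimes> y\<close>, because \<open>r \<otimes> y = 1 \<otimes> r y\<close>.
\<close>

lemma self_module_tensor_unit:
  assumes P: "module R P" and c: "Poly_Mapping.keys c \<subseteq> carrier R \<times> carrier P"
  shows "\<exists>y\<in>carrier P. c - frag_of (\<one>\<^bsub>R\<^esub>, y) \<in> tensor_kernel R (self_module R) P"
proof -
  interpret P: module R P by fact
  interpret module_pair R "self_module R" P
    by (intro module_pairI module_self_module P P.R.is_cring)
  have "\<exists>y\<in>carrier P. teq c (frag_of (\<one>\<^bsub>R\<^esub>, y))"
    using c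
  proof (induction c rule: free_Abelian_group_induct[consumes 1])
    case 1
    have "teq 0 (frag_of (\<one>\<^bsub>R\<^esub>, \<zero>\<^bsub>P\<^esub>))"
      using zero_right_in_kernel[of "\<one>\<^bsub>R\<^esub>"] teq_sym[of _ 0] by (simp add: kernel_iff_teq)
    then show ?case by blast
  next
    case (2 c d)
    then obtain y z where y: "y \<in> carrier P" "teq c (frag_of (\<one>\<^bsub>R\<^esub>, y))"
      and z: "z \<in> carrier P" "teq d (frag_of (\<one>\<^bsub>R\<^esub>, z))" by blast
    have "teq (c - d) (frag_of (\<one>\<^bsub>R\<^esub>, y) - frag_of (\<one>\<^bsub>R\<^esub>, z))" by (rule teq_diff[OF y(2) z(2)])
    also have "teq \<dots> (frag_of (\<one>\<^bsub>R\<^esub>, y \<ominus>\<^bsub>P\<^esub> z))"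
      using y(1) z(1) by (intro teq_sym[OF teq_minus_right]) auto
    finally show ?case using y(1) z(1) by (intro bexI[of _ "y \<ominus>\<^bsub>P\<^esub> z"]) auto
  next
    case (3 p)
    then obtain r y where p: "p = (r, y)" "r \<in> carrier R" "y \<in> carrier P" by auto
    then show ?case
      using teq_balanced[of r "\<one>\<^bsub>R\<^esub>" y] by (intro bexI[of _ "r \<odot>\<^bsub>P\<^esub> y"]) auto
  qed
  then show ?thesis by (simp add: teq_def)
qed

text \<open>
  By the two preceding lemmas \<open>y \<mapsto> 1 \<otimes> y\<close> identifies \<open>P\<close> with \<open>R \<otimes> P\<close>, and \<open>v \<otimes> id\<close> sends \<open>1 \<otimes> y\<close> to \<open>v 1 \<otimes> y\<close>.
\<close>

lemma inj_on_tensor_map_from_ring_iff: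
  assumes M: "module R M" and P: "module R P" and v: "v \<in> linear_maps R (self_module R) M"
  shows "inj_on (tensor_map R M P v id) (carrier (tensor R (self_module R) P)) \<longleftrightarrow>
    (\<forall>y\<in>carrier P. frag_of (v \<one>\<^bsub>R\<^esub>, y) \<in> tensor_kernel R M P \<longrightarrow> y = \<zero>\<^bsub>P\<^esub>)" (is "?inj \<longleftrightarrow> ?van")
proof -
  interpret P: module R P by fact
  interpret S: module_pair R "self_module R" P
    by (intro module_pairI module_self_module P P.R.is_cring)
  interpret T: module_pair R M P
    by (intro module_pairI M P)
  have id: "id \<in> linear_maps R P P" by (simp add: linear_maps_def)
  let ?E = "frag_extend (\<lambda>(r, y). frag_of (v r, id y))"
  have inj_iff: "?inj \<longleftrightarrow> (\<forall>c. Poly_Mapping.keys c \<subseteq> carrier R \<times> carrier P \<longrightarrow> ?E c \<in> T.K \<longrightarrow> c \<in> S.K)"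
    using inj_on_tensor_map_iff[OF S.module_pair_axioms T.module_pair_axioms v id] by simp
  show ?thesis
  proof
    assume ?inj
    then show ?van
      unfolding inj_iff
    proof (intro ballI impI)
      fix y assume ker: "\<forall>c. Poly_Mapping.keys c \<subseteq> carrier R \<times> carrier P \<longrightarrow> ?E c \<in> T.K \<longrightarrow> c \<in> S.K"
        and y: "y \<in> carrier P" "frag_of (v \<one>\<^bsub>R\<^esub>, y) \<in> T.K"
      from ker[rule_format, of "frag_of (\<one>\<^bsub>R\<^esub>, y)"] y
      have "frag_of (\<one>\<^bsub>R\<^esub>, y) \<in> S.K" by (simp add: keys_frag_of)
      with P y(1) show "y = \<zero>\<^bsub>P\<^esub>" by (rule self_module_kernel)
    qed
  next
    assume van: ?van
    have E_kernel: "?E c \<in> T.K" if "c \<in> S.K" for c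
      using tensor_kernel_map[OF S.module_pair_axioms T.module_pair_axioms v id that] .
    show ?inj
      unfolding inj_iff
    proof (intro allI impI)
      fix c assume c: "Poly_Mapping.keys c \<subseteq> carrier R \<times> carrier P" "?E c \<in> T.K"
      obtain y where y: "y \<in> carrier P" "c - frag_of (\<one>\<^bsub>R\<^esub>, y) \<in> S.K"
        using self_module_tensor_unit[OF P c(1)] by blast
      have "?E c - frag_of (v \<one>\<^bsub>R\<^esub>, y) \<in> T.K"
        using E_kernel[OF y(2)] by (simp add: frag_extend_diff)
      with c(2) have "frag_of (v \<one>\<^bsub>R\<^esub>, y) \<in> T.K"
        using T.kernel_diff[of "?E c" "?E c - frag_of (v \<one>\<^bsub>R\<^esub>, y)"] by simp
      with van y have "y = \<zero>\<^bsub>P\<^esub>" by blast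
      then have "frag_of (\<one>\<^bsub>R\<^esub>, y) \<in> S.K" using S.zero_right_in_kernel by simp
      with y(2) show "c \<in> S.K" using S.kernel_add[of "c - frag_of (\<one>\<^bsub>R\<^esub>, y)" "frag_of (\<one>\<^bsub>R\<^esub>, y)"] by simp
    qed
  qed
qed

section \<open>Purity and content over a flat module\<close>

text \<open>
  Let \<open>I\<close> be the annihilator of \<open>y\<close>. By flatness \<open>M \<otimes> R y\<close> embeds into \<open>M \<otimes> P\<close>, so \<open>x \<otimes> y\<close> vanishes already in
  \<open>M \<otimes> R y\<close>. Since \<open>R y\<close> is isomorphic to \<open>R / I\<close>, there is a map from \<open>M \<otimes> R y\<close> to \<open>M / I M\<close> sending \<open>m \<otimes> r y\<close> to the
  class of \<open>r m\<close>; it sends \<open>x \<otimes> y\<close> to the class of \<open>x\<close>.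
\<close>

lemma flat_annihilator:
  fixes P :: "('a, 'p) module"
  assumes flat: "flat_module TYPE('p) R M" and M: "module R M" and P: "module R P"
    and x: "x \<in> carrier M" and y: "y \<in> carrier P" and k: "frag_of (x, y) \<in> tensor_kernel R M P"
  shows "x \<in> ideal_smult (module.annihilator R P y) M"
proof -
  interpret P: module R P by fact
  interpret M: module R M by fact
  interpret MP: module_pair R M P by (intro module_pairI M P)
  let ?I = "P.annihilator y"
  have I: "ideal ?I R" by (rule P.annihilator_ideal[OF y])
  interpret IM: subgroup "ideal_smult ?I M" "add_monoid M" by (rule M.ideal_smult_subgroup[OF I])
  define H where "H = (\<lambda>r. r \<odot>\<^bsub>P\<^esub> y) ` carrier R"
  let ?N = "P\<lparr>carrier := H\<rparr>"
  have "submodule H R P"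
  proof (rule P.submoduleI)
    show "\<zero>\<^bsub>P\<^esub> \<in> H" unfolding H_def using y by (intro image_eqI[of _ _ "\<zero>\<^bsub>R\<^esub>"]) auto
    show "\<ominus>\<^bsub>P\<^esub> a \<in> H" if "a \<in> H" for a
      using that y unfolding H_def by (auto simp: P.smult_l_minus[symmetric])
    show "a \<oplus>\<^bsub>P\<^esub> b \<in> H" if "a \<in> H" "b \<in> H" for a b
      using that y unfolding H_def by (auto simp: P.smult_l_distr[symmetric])
    show "a \<odot>\<^bsub>P\<^esub> b \<in> H" if "a \<in> carrier R" "b \<in> H" for a b
      using that y unfolding H_def by (auto simp: P.smult_assoc1[symmetric])
  qed (use y in \<open>auto simp: H_def\<close>)
  then have N: "module R ?N" by (rule submodule.submodule_is_module[OF _ P])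
  interpret MN: module_pair R M ?N by (intro module_pairI M N)
  have HP: "H \<subseteq> carrier P" using y by (auto simp: H_def)
  have yH: "y \<in> H" unfolding H_def using y by (intro image_eqI[of _ _ "\<one>\<^bsub>R\<^esub>"]) auto
  have id: "id \<in> linear_maps R M M" "id \<in> linear_maps R ?N P"
    using HP by (auto simp: linear_maps_def)
  have "inj_on (tensor_map R M P id id) (carrier (tensor R M ?N))"
    using flat N P id(2) unfolding flat_module_def by fastforce
  then have k': "frag_of (x, y) \<in> MN.K"
    unfolding inj_on_tensor_map_iff[OF MN.module_pair_axioms MP.module_pair_axioms id]
    using k x yH by (auto simp: keys_frag_of)
  (* c z is some coefficient with c z y = z. It is determined only modulo the annihilator of y,
     so (m, z) \<mapsto> c z m is bilinear only modulo I M. *)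
  define c where "c z = (SOME r. r \<in> carrier R \<and> r \<odot>\<^bsub>P\<^esub> y = z)" for z
  have c: "c z \<in> carrier R" "c z \<odot>\<^bsub>P\<^esub> y = z" if "z \<in> H" for z
  proof -
    have "\<exists>r. r \<in> carrier R \<and> r \<odot>\<^bsub>P\<^esub> y = z" using that by (auto simp: H_def)
    from someI_ex[OF this] show "c z \<in> carrier R" "c z \<odot>\<^bsub>P\<^esub> y = z" by (simp_all add: c_def)
  qed
  have IM: "r \<odot>\<^bsub>M\<^esub> m \<in> ideal_smult ?I M" if "r \<in> carrier R" "r \<odot>\<^bsub>P\<^esub> y = \<zero>\<^bsub>P\<^esub>" "m \<in> carrier M" for r m
    using that by (intro M.smult_in_ideal_smult) (auto simp: P.annihilator_def)
  have add_closed: "z \<oplus>\<^bsub>P\<^esub> z' \<in> H" if "z \<in> H" "z' \<in> H" for z z'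
    using MN.N.M.a_closed[of z z'] that by auto
  have smult_closed: "r \<odot>\<^bsub>P\<^esub> z \<in> H" if "r \<in> carrier R" "z \<in> H" for r z
    using MN.N.smult_closed[of r z] that by auto
  have "(case (x, y) of (m, z) \<Rightarrow> c z \<odot>\<^bsub>M\<^esub> m) \<in> ideal_smult ?I M"
  proof (rule MN.kernel_additive_target[OF M.abelian_group_axioms IM.subgroup_axioms,
        where b = "\<lambda>(m, z). c z \<odot>\<^bsub>M\<^esub> m"], unfold split)
    fix m m' z assume *: "m \<in> carrier M" "m' \<in> carrier M" "z \<in> carrier ?N"
    have "c z \<odot>\<^bsub>M\<^esub> (m \<oplus>\<^bsub>M\<^esub> m') \<ominus>\<^bsub>M\<^esub> c z \<odot>\<^bsub>M\<^esub> m \<ominus>\<^bsub>M\<^esub> c z \<odot>\<^bsub>M\<^esub> m' = \<zero>\<^bsub>M\<^esub>"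
      using * c by (simp add: M.smult_r_distr M.M.add_minus_cancel_both)
    then show "c z \<odot>\<^bsub>M\<^esub> (m \<oplus>\<^bsub>M\<^esub> m') \<ominus>\<^bsub>M\<^esub> c z \<odot>\<^bsub>M\<^esub> m \<ominus>\<^bsub>M\<^esub> c z \<odot>\<^bsub>M\<^esub> m' \<in> ideal_smult ?I M" by simp
  next
    fix m z z' assume *: "m \<in> carrier M" "z \<in> carrier ?N" "z' \<in> carrier ?N"
    let ?r = "c (z \<oplus>\<^bsub>P\<^esub> z') \<ominus>\<^bsub>R\<^esub> c z \<ominus>\<^bsub>R\<^esub> c z'"
    have c': "c z \<in> carrier R" "c z' \<in> carrier R" "c (z \<oplus>\<^bsub>P\<^esub> z') \<in> carrier R"
      using * c add_closed smult_closed by auto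
    have zP: "z \<in> carrier P" "z' \<in> carrier P" using * HP by auto
    have "?r \<odot>\<^bsub>P\<^esub> y = (z \<oplus>\<^bsub>P\<^esub> z') \<ominus>\<^bsub>P\<^esub> z \<ominus>\<^bsub>P\<^esub> z'"
      using * c' y c add_closed smult_closed by (simp add: P.R.minus_eq P.M.minus_eq P.smult_l_distr P.smult_l_minus)
    also have "\<dots> = \<zero>\<^bsub>P\<^esub>"
      using zP by (rule P.M.add_minus_cancel_both)
    finally have "?r \<odot>\<^bsub>M\<^esub> m \<in> ideal_smult ?I M" using c' * by (intro IM) auto
    then show "c (z \<oplus>\<^bsub>?N\<^esub> z') \<odot>\<^bsub>M\<^esub> m \<ominus>\<^bsub>M\<^esub> c z \<odot>\<^bsub>M\<^esub> m \<ominus>\<^bsub>M\<^esub> c z' \<odot>\<^bsub>M\<^esub> m \<in> ideal_smult ?I M"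
      using c' * by (simp add: P.R.minus_eq M.M.minus_eq M.smult_l_distr M.smult_l_minus)
  next
    fix r m z assume *: "r \<in> carrier R" "m \<in> carrier M" "z \<in> carrier ?N"
    let ?r = "c z \<otimes>\<^bsub>R\<^esub> r \<ominus>\<^bsub>R\<^esub> c (r \<odot>\<^bsub>P\<^esub> z)"
    have c': "c z \<in> carrier R" "c (r \<odot>\<^bsub>P\<^esub> z) \<in> carrier R"
      using * c add_closed smult_closed by auto
    have "?r \<odot>\<^bsub>P\<^esub> y = r \<odot>\<^bsub>P\<^esub> (c z \<odot>\<^bsub>P\<^esub> y) \<ominus>\<^bsub>P\<^esub> c (r \<odot>\<^bsub>P\<^esub> z) \<odot>\<^bsub>P\<^esub> y"
      using * c' y
      by (simp add: P.R.minus_eq P.M.minus_eq P.smult_l_distr P.smult_l_minus P.smult_assoc1 P.R.m_comm[of _ r])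
    also have "\<dots> = \<zero>\<^bsub>P\<^esub>"
      using * c add_closed smult_closed HP by (simp add: P.M.minus_eq P.M.r_neg subset_iff)
    finally have "?r \<odot>\<^bsub>M\<^esub> m \<in> ideal_smult ?I M" using c' * by (intro IM) auto
    then show "c z \<odot>\<^bsub>M\<^esub> (r \<odot>\<^bsub>M\<^esub> m) \<ominus>\<^bsub>M\<^esub> c (r \<odot>\<^bsub>?N\<^esub> z) \<odot>\<^bsub>M\<^esub> m \<in> ideal_smult ?I M"
      using c' * by (simp add: P.R.minus_eq M.M.minus_eq M.smult_l_distr M.smult_l_minus M.smult_assoc1)
  qed (use c k' x yH in auto)
  (* c y need not be 1, but 1 - c y annihilates y. *)
  then have cx: "c y \<odot>\<^bsub>M\<^esub> x \<in> ideal_smult ?I M" by simp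
  have cy: "c y \<in> carrier R" "c y \<odot>\<^bsub>P\<^esub> y = y" using c yH by auto
  have "(\<one>\<^bsub>R\<^esub> \<ominus>\<^bsub>R\<^esub> c y) \<odot>\<^bsub>M\<^esub> x \<in> ideal_smult ?I M"
    using cy x y by (intro IM) (auto simp: P.R.minus_eq P.smult_l_distr P.smult_l_minus P.M.r_neg)
  from IM.m_closed[OF this cx] show ?thesis
    using cy x by (simp add: P.R.minus_eq M.smult_l_distr M.smult_l_minus M.M.a_assoc M.M.l_neg)
qed


lemma module_homomorphic_image:
  assumes N: "module R N" and surj: "carrier P = q ` carrier N"
    and q_add: "\<And>x y. \<lbrakk>x \<in> carrier N; y \<in> carrier N\<rbrakk> \<Longrightarrow> q x \<oplus>\<^bsub>P\<^esub> q y = q (x \<oplus>\<^bsub>N\<^esub> y)"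
    and q_smult: "\<And>r x. \<lbrakk>r \<in> carrier R; x \<in> carrier N\<rbrakk> \<Longrightarrow> r \<odot>\<^bsub>P\<^esub> q x = q (r \<odot>\<^bsub>N\<^esub> x)"
    and q_zero: "\<zero>\<^bsub>P\<^esub> = q \<zero>\<^bsub>N\<^esub>"
  shows "module R P"
proof -
  interpret N: module R N by fact
  have "abelian_group P"
  proof (rule abelian_groupI)
    fix x assume "x \<in> carrier P"
    then obtain a where "x = q a" "a \<in> carrier N" using surj by auto
    then show "\<exists>y\<in>carrier P. y \<oplus>\<^bsub>P\<^esub> x = \<zero>\<^bsub>P\<^esub>"
      by (intro bexI[of _ "q (\<ominus>\<^bsub>N\<^esub> a)"]) (auto simp: surj q_add q_zero N.M.l_neg)
  next
    fix x y assume "x \<in> carrier P" "y \<in> carrier P"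
    then show "x \<oplus>\<^bsub>P\<^esub> y = y \<oplus>\<^bsub>P\<^esub> x"
      using N.M.a_comm by (auto simp: surj q_add)
  qed (auto simp: surj q_add q_zero N.M.a_assoc)
  then show ?thesis
    by (intro moduleI N.R.is_cring)
       (auto simp: surj q_add q_smult N.smult_l_distr N.smult_r_distr N.smult_assoc1)
qed

text \<open>
  The module is \<open>R / I\<close>. Its elements have to be drawn from \<open>'p\<close>, so a coset is represented by the image under \<open>e\<close> of
  a chosen member.
\<close>

lemma cyclic_module_with_annihilator:
  fixes R :: "('a, 'r) ring_scheme" and e :: "'a \<Rightarrow> 'p"
  assumes R: "cring R" and I: "ideal I R" and e: "inj_on e (carrier R)"
  obtains P :: "('a, 'p) module" and u
    where "cyclic_module R P" "u \<in> carrier P" "\<And>a. a \<in> carrier R \<Longrightarrow> a \<odot>\<^bsub>P\<^esub> u = \<zero>\<^bsub>P\<^esub> \<longleftrightarrow> a \<in> I"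
proof -
  interpret R: cring R by fact
  interpret I: ideal I R by fact
  define rep where "rep a = (SOME b. b \<in> I +>\<^bsub>R\<^esub> a)" for a
  define q where "q a = e (rep a)" for a
  have rep: "rep a \<in> carrier R" "I +>\<^bsub>R\<^esub> rep a = I +>\<^bsub>R\<^esub> a" if a: "a \<in> carrier R" for a
  proof -
    have "rep a \<in> I +>\<^bsub>R\<^esub> a" unfolding rep_def by (rule someI) (rule I.a_rcos_self[OF a])
    then show "rep a \<in> carrier R" "I +>\<^bsub>R\<^esub> rep a = I +>\<^bsub>R\<^esub> a"
      using a I.a_repr_independence'[of "rep a" a] R.a_r_coset_subset_G[OF I.a_subset a] by auto
  qed
  have q_eq: "q a = q b \<longleftrightarrow> a \<ominus>\<^bsub>R\<^esub> b \<in> I" if "a \<in> carrier R" "b \<in> carrier R" for a b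
  proof -
    have "q a = q b \<longleftrightarrow> rep a = rep b"
      using that rep(1) inj_on_eq_iff[OF e, of "rep a" "rep b"] by (simp add: q_def)
    also have "\<dots> \<longleftrightarrow> I +>\<^bsub>R\<^esub> a = I +>\<^bsub>R\<^esub> b"
      using rep(2)[OF that(1)] rep(2)[OF that(2)] unfolding rep_def by metis
    finally have "q a = q b \<longleftrightarrow> I +>\<^bsub>R\<^esub> a = I +>\<^bsub>R\<^esub> b" .
    then show ?thesis using R.quotient_eq_iff_same_a_r_cos[OF I that] by simp
  qed
  define g where "g = inv_into (carrier R) q"
  define P :: "('a, 'p) module" where "P = \<lparr>carrier = q ` carrier R, mult = undefined, one = undefined,
    zero = q \<zero>\<^bsub>R\<^esub>, add = (\<lambda>u w. q (g u \<oplus>\<^bsub>R\<^esub> g w)), smult = (\<lambda>r u. q (r \<otimes>\<^bsub>R\<^esub> g u))\<rparr>"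
  have g: "g (q a) \<in> carrier R" "g (q a) \<ominus>\<^bsub>R\<^esub> a \<in> I" if "a \<in> carrier R" for a
  proof -
    show "g (q a) \<in> carrier R" unfolding g_def using that by (intro inv_into_into) auto
    moreover have "q (g (q a)) = q a" unfolding g_def using that by (intro f_inv_into_f) auto
    ultimately show "g (q a) \<ominus>\<^bsub>R\<^esub> a \<in> I" using q_eq that by simp
  qed
  have P_add: "q a \<oplus>\<^bsub>P\<^esub> q b = q (a \<oplus>\<^bsub>R\<^esub> b)" if ab: "a \<in> carrier R" "b \<in> carrier R" for a b
  proof -
    have "(g (q a) \<oplus>\<^bsub>R\<^esub> g (q b)) \<ominus>\<^bsub>R\<^esub> (a \<oplus>\<^bsub>R\<^esub> b) = (g (q a) \<ominus>\<^bsub>R\<^esub> a) \<oplus>\<^bsub>R\<^esub> (g (q b) \<ominus>\<^bsub>R\<^esub> b)"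
      using ab g(1) by (simp add: R.minus_eq R.minus_add R.a_ac)
    also have "\<dots> \<in> I" using ab g by (intro I.a_closed) auto
    finally show ?thesis using ab g q_eq by (simp add: P_def)
  qed
  have P_smult: "r \<odot>\<^bsub>P\<^esub> q a = q (r \<otimes>\<^bsub>R\<^esub> a)" if ra: "r \<in> carrier R" "a \<in> carrier R" for r a
  proof -
    have "r \<otimes>\<^bsub>R\<^esub> g (q a) \<ominus>\<^bsub>R\<^esub> r \<otimes>\<^bsub>R\<^esub> a = r \<otimes>\<^bsub>R\<^esub> (g (q a) \<ominus>\<^bsub>R\<^esub> a)"
      using ra g(1) by (simp add: R.minus_eq R.r_distr R.r_minus)
    also have "\<dots> \<in> I" using ra g by (intro I.I_l_closed) auto
    finally show ?thesis using ra g q_eq by (simp add: P_def)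
  qed
  have module_P: "module R P"
    by (rule module_homomorphic_image[OF module_self_module[OF R], where q = q])
       (auto simp: P_add P_smult, simp_all add: P_def)
  have smult_unit: "a \<odot>\<^bsub>P\<^esub> q \<one>\<^bsub>R\<^esub> = q a" if "a \<in> carrier R" for a
    using that P_smult[of a "\<one>\<^bsub>R\<^esub>"] by simp
  have carrier_P: "carrier P = q ` carrier R" by (simp add: P_def)
  show thesis
  proof
    show "cyclic_module R P"
      unfolding cyclic_module_def carrier_P
      using module_P smult_unit by (intro conjI bexI[of _ "q \<one>\<^bsub>R\<^esub>"]) (auto intro: image_cong)
    show "q \<one>\<^bsub>R\<^esub> \<in> carrier P" by (simp add: carrier_P)
    show "a \<odot>\<^bsub>P\<^esub> q \<one>\<^bsub>R\<^esub> = \<zero>\<^bsub>P\<^esub> \<longleftrightarrow> a \<in> I" if a: "a \<in> carrier R" for a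
      using a q_eq[OF a R.zero_closed] by (simp add: smult_unit) (simp add: P_def R.minus_eq)
  qed
qed

text \<open>
  Test on \<open>P = R / I\<close> with generator \<open>u\<close>: since \<open>v 1\<close> lies in \<open>I M\<close>, the tensor \<open>v 1 \<otimes> u\<close> vanishes. Injectivity of
  \<open>v \<otimes> P\<close> then gives \<open>u = 0\<close>, that is, \<open>1 \<in> I\<close>.
\<close>

lemma ideal_eq_carrier_if_cyclically_pure:
  fixes R :: "('a, 'r) ring_scheme" and e :: "'a \<Rightarrow> 'p"
  assumes e: "inj_on e (carrier R)" and M: "module R M" and v: "v \<in> linear_maps R (self_module R) M"
    and pure: "cyclically_pure_map TYPE('p) R (self_module R) M v"
    and I: "ideal I R" and x: "v \<one>\<^bsub>R\<^esub> \<in> ideal_smult I M"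
  shows "I = carrier R"
proof -
  interpret M: module R M by fact
  obtain P :: "('a, 'p) module" and u where P: "cyclic_module R P" and u: "u \<in> carrier P"
    and ann: "\<And>a. a \<in> carrier R \<Longrightarrow> a \<odot>\<^bsub>P\<^esub> u = \<zero>\<^bsub>P\<^esub> \<longleftrightarrow> a \<in> I"
    using cyclic_module_with_annihilator[OF M.R.is_cring I e] by blast
  have P': "module R P" using P by (simp add: cyclic_module_def)
  interpret P: module R P by fact
  have IR: "I \<subseteq> carrier R" using I by (simp add: ideal.Icarr subsetI)
  interpret MP: module_pair R M P by (intro module_pairI M P')
  have "frag_of (v \<one>\<^bsub>R\<^esub>, u) \<in> MP.K"
    using ann IR by (intro MP.smult_in_kernel_if_annihilated[OF IR x u]) auto
  moreover have "inj_on (tensor_map R M P v id) (carrier (tensor R (self_module R) P))"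
    using pure P by (simp add: cyclically_pure_map_def)
  ultimately have "u = \<zero>\<^bsub>P\<^esub>"
    using u by (simp add: inj_on_tensor_map_from_ring_iff[OF M P' v])
  then have "\<one>\<^bsub>R\<^esub> \<in> I" using ann[of "\<one>\<^bsub>R\<^esub>"] by simp
  then show ?thesis using ideal.one_imp_carrier[OF I] by simp
qed

lemma (in module) carrier_ideal_smult:
  assumes x: "x \<in> carrier M"
  shows "x \<in> ideal_smult (carrier R) M"
  using smult_in_ideal_smult[of "carrier R" "\<one>" x] x by simp

lemma (in module) module_content_eq_carrier_iff:
  assumes "x \<in> carrier M"
  shows "module_content R M x = carrier R \<longleftrightarrow> (\<forall>I. ideal I R \<and> x \<in> ideal_smult I M \<longrightarrow> I = carrier R)"
proof
  assume c: "module_content R M x = carrier R"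
  show "\<forall>I. ideal I R \<and> x \<in> ideal_smult I M \<longrightarrow> I = carrier R"
  proof (intro allI impI)
    fix I assume I: "ideal I R \<and> x \<in> ideal_smult I M"
    then have "carrier R \<subseteq> I" unfolding c[symmetric] module_content_def by (intro Inter_lower) simp
    moreover have "I \<subseteq> carrier R" using I by (intro additive_subgroup.a_subset ideal.axioms(1)) simp
    ultimately show "I = carrier R" by simp
  qed
next
  assume *: "\<forall>I. ideal I R \<and> x \<in> ideal_smult I M \<longrightarrow> I = carrier R"
  have "ideal I R \<and> x \<in> ideal_smult I M \<longleftrightarrow> I = carrier R" for I
    using *[rule_format, of I] carrier_ideal_smult[OF assms] R.oneideal by metis
  then have "{I. ideal I R \<and> x \<in> ideal_smult I M} = {carrier R}" by simp
  then show "module_content R M x = carrier R" by (simp add: module_content_def)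
qed

lemma pure_imp_cyclically_pure: "pure_map U R M N v \<Longrightarrow> cyclically_pure_map U R M N v"
  by (auto simp: pure_map_def cyclically_pure_map_def cyclic_module_def)

text \<open>
  Suppose the content of \<open>v 1\<close> is \<open>R\<close>, and \<open>v 1 \<otimes> y = 0\<close>. By \<open>flat_annihilator\<close> the annihilator of \<open>y\<close> is one of the ideals
  whose intersection is the content, so it is \<open>R\<close>, whence \<open>y = 0\<close>. The converse is the preceding test on the
  quotients \<open>R / I\<close>.
\<close>

theorem pure_iff_content_eq_carrier:
  fixes R :: "('a, 'r) ring_scheme" and e :: "'a \<Rightarrow> 'p"
  assumes e: "inj_on e (carrier R)" and M: "module R M"
    and flat: "flat_module TYPE('p) R M" and v: "v \<in> linear_maps R (self_module R) M"
  shows "pure_map TYPE('p) R (self_module R) M v \<longleftrightarrow> module_content R M (v \<one>\<^bsub>R\<^esub>) = carrier R"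
proof -
  interpret M: module R M by fact
  have x: "v \<one>\<^bsub>R\<^esub> \<in> carrier M" using v by (auto simp: linear_maps_def)
  show ?thesis
    unfolding M.module_content_eq_carrier_iff[OF x]
  proof (intro iffI allI impI)
    fix I assume "pure_map TYPE('p) R (self_module R) M v" and I: "ideal I R \<and> v \<one>\<^bsub>R\<^esub> \<in> ideal_smult I M"
    then show "I = carrier R"
      using ideal_eq_carrier_if_cyclically_pure[OF e M v pure_imp_cyclically_pure] by blast
  next
    assume content: "\<forall>I. ideal I R \<and> v \<one>\<^bsub>R\<^esub> \<in> ideal_smult I M \<longrightarrow> I = carrier R"
    show "pure_map TYPE('p) R (self_module R) M v"
      unfolding pure_map_def
    proof (intro allI impI)
      fix P :: "('a, 'p) module" assume P: "module R P"
      interpret P: module R P by fact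
      show "inj_on (tensor_map R M P v id) (carrier (tensor R (self_module R) P))"
        unfolding inj_on_tensor_map_from_ring_iff[OF M P v]
      proof (intro ballI impI)
        fix y assume y: "y \<in> carrier P" "frag_of (v \<one>\<^bsub>R\<^esub>, y) \<in> tensor_kernel R M P"
        have "v \<one>\<^bsub>R\<^esub> \<in> ideal_smult (P.annihilator y) M"
          by (rule flat_annihilator[OF flat M P x y])
        then have "P.annihilator y = carrier R" using content P.annihilator_ideal[OF y(1)] by blast
        then show "y = \<zero>\<^bsub>P\<^esub>" using P.annihilatorD[of "\<one>\<^bsub>R\<^esub>" y] y(1) by simp
      qed
    qed
  qed
qed


section \<open>Localization\<close>

locale multiplicative_set = cring R for R (structure) +
  fixes S
  assumes S_subset: "S \<subseteq> carrier R"
    and one_in_S [simp]: "\<one> \<in> S"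
    and S_mult [simp]: "s \<in> S \<Longrightarrow> t \<in> S \<Longrightarrow> s \<otimes> t \<in> S"
begin

lemma S_carrier [simp]: "s \<in> S \<Longrightarrow> s \<in> carrier R"
  using S_subset by auto

lemma equiv_fraction_rel:
  assumes M: "module R M"
  shows "equiv (carrier M \<times> S) (fraction_rel R S M)"
proof -
  interpret M: module R M by fact
  show ?thesis
  proof (rule equivI)
    show "fraction_rel R S M \<subseteq> (carrier M \<times> S) \<times> (carrier M \<times> S)"
      by (auto simp: fraction_rel_def)
    show "refl_on (carrier M \<times> S) (fraction_rel R S M)"
      by (rule refl_onI) (auto simp: fraction_rel_def intro: bexI[OF _ one_in_S])
    show "sym (fraction_rel R S M)"
      by (rule symI) (auto simp: fraction_rel_def intro: sym)
    show "trans (fraction_rel R S M)"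
    proof (rule transI)
      fix p q r assume pq: "(p, q) \<in> fraction_rel R S M" and qr: "(q, r) \<in> fraction_rel R S M"
      obtain x s y t z w where p: "p = (x, s)" and q: "q = (y, t)" and r: "r = (z, w)"
        by (metis surj_pair)
      from pq obtain u where xy: "x \<in> carrier M" "y \<in> carrier M" "s \<in> S" "t \<in> S" "u \<in> S"
        and u: "u \<odot>\<^bsub>M\<^esub> (t \<odot>\<^bsub>M\<^esub> x) = u \<odot>\<^bsub>M\<^esub> (s \<odot>\<^bsub>M\<^esub> y)" by (auto simp: fraction_rel_def p q)
      from qr obtain u' where zw: "z \<in> carrier M" "w \<in> S" "u' \<in> S"
        and u': "u' \<odot>\<^bsub>M\<^esub> (w \<odot>\<^bsub>M\<^esub> y) = u' \<odot>\<^bsub>M\<^esub> (t \<odot>\<^bsub>M\<^esub> z)" by (auto simp: fraction_rel_def q r)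
      have "(u \<otimes> u' \<otimes> t) \<odot>\<^bsub>M\<^esub> (w \<odot>\<^bsub>M\<^esub> x) = (u' \<otimes> w) \<odot>\<^bsub>M\<^esub> (u \<odot>\<^bsub>M\<^esub> (t \<odot>\<^bsub>M\<^esub> x))"
        using xy zw by (simp add: M.smult_assoc1[symmetric] m_ac)
      also have "\<dots> = (u \<otimes> s) \<odot>\<^bsub>M\<^esub> (u' \<odot>\<^bsub>M\<^esub> (w \<odot>\<^bsub>M\<^esub> y))"
        unfolding u using xy zw by (simp add: M.smult_assoc1[symmetric] m_ac)
      also have "\<dots> = (u \<otimes> u' \<otimes> t) \<odot>\<^bsub>M\<^esub> (s \<odot>\<^bsub>M\<^esub> z)"
        unfolding u' using xy zw by (simp add: M.smult_assoc1[symmetric] m_ac)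
      finally show "(p, r) \<in> fraction_rel R S M"
        using xy zw by (auto simp: fraction_rel_def p r)
    qed
  qed
qed

lemma fraction_eq_iff:
  assumes "module R M" "x \<in> carrier M" "y \<in> carrier M" "s \<in> S" "t \<in> S"
  shows "fraction R S M x s = fraction R S M y t \<longleftrightarrow>
    (\<exists>u\<in>S. u \<odot>\<^bsub>M\<^esub> (t \<odot>\<^bsub>M\<^esub> x) = u \<odot>\<^bsub>M\<^esub> (s \<odot>\<^bsub>M\<^esub> y))"
  using eq_equiv_class_iff[OF equiv_fraction_rel[OF assms(1)], of "(x, s)" "(y, t)"] assms
  by (simp add: fraction_def fraction_rel_def)

lemma fraction_cancel:
  assumes M: "module R M" and "x \<in> carrier M" "y \<in> carrier M" "s \<in> S" "t \<in> S"
    and eq: "t \<odot>\<^bsub>M\<^esub> x = s \<odot>\<^bsub>M\<^esub> y"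
  shows "fraction R S M x s = fraction R S M y t"
  using assms by (auto simp: fraction_eq_iff[OF M])

lemma fraction_self:
  assumes "module R M" "x \<in> carrier M" "s \<in> S"
  shows "(x, s) \<in> fraction R S M x s"
  unfolding fraction_def
  by (rule equiv_class_self[OF equiv_fraction_rel[OF assms(1)]]) (use assms in simp)

lemma fraction_member:
  assumes "module R M" "(y, t) \<in> fraction R S M x s"
  shows "x \<in> carrier M" "y \<in> carrier M" "s \<in> S" "t \<in> S" "\<exists>u\<in>S. u \<odot>\<^bsub>M\<^esub> (t \<odot>\<^bsub>M\<^esub> x) = u \<odot>\<^bsub>M\<^esub> (s \<odot>\<^bsub>M\<^esub> y)"
  using assms by (auto simp: fraction_def fraction_rel_def)

text \<open>
  The operations on fractions are unions over representatives. This rule evaluates such a union as soon as the value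
  does not depend on the representative.
\<close>

lemma UN_fraction:
  assumes M: "module R M" "x \<in> carrier M" "s \<in> S"
    and f: "\<And>y t u. \<lbrakk>y \<in> carrier M; t \<in> S; u \<in> S; u \<odot>\<^bsub>M\<^esub> (t \<odot>\<^bsub>M\<^esub> x) = u \<odot>\<^bsub>M\<^esub> (s \<odot>\<^bsub>M\<^esub> y)\<rbrakk> \<Longrightarrow> f y t = f x s"
  shows "(\<Union>(y, t)\<in>fraction R S M x s. f y t) = f x s"
proof -
  have "(case p of (y, t) \<Rightarrow> f y t) = f x s" if "p \<in> fraction R S M x s" for p
  proof -
    obtain y t where p: "p = (y, t)" by (cases p)
    from fraction_member[OF M(1), of y t x s] that p
    obtain u where "y \<in> carrier M" "t \<in> S" "u \<in> S" "u \<odot>\<^bsub>M\<^esub> (t \<odot>\<^bsub>M\<^esub> x) = u \<odot>\<^bsub>M\<^esub> (s \<odot>\<^bsub>M\<^esub> y)"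
      by blast
    from f[OF this] p show ?thesis by simp
  qed
  moreover have "fraction R S M x s \<noteq> {}" using fraction_self[OF M] by blast
  ultimately show ?thesis by (intro SUP_eq_const)
qed

lemma localized_module_carrier:
  "carrier (localized_module R S M) = (\<lambda>(x, s). fraction R S M x s) ` (carrier M \<times> S)"
  by (auto simp: localized_module_def quotient_def fraction_def)

lemma fraction_closed [simp]:
  "x \<in> carrier M \<Longrightarrow> s \<in> S \<Longrightarrow> fraction R S M x s \<in> carrier (localized_module R S M)"
  by (auto simp: localized_module_carrier)

lemma fraction_cases:
  assumes "X \<in> carrier (localized_module R S M)"
  obtains x s where "x \<in> carrier M" "s \<in> S" "X = fraction R S M x s"
  using assms by (auto simp: localized_module_carrier)

lemma localized_module_zero: "\<zero>\<^bsub>localized_module R S M\<^esub> = fraction R S M \<zero>\<^bsub>M\<^esub> \<one>"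
  by (simp add: localized_module_def)

text \<open>
  If \<open>u\<close> witnesses \<open>x / s = x' / s'\<close> and \<open>w\<close> witnesses \<open>y / t = y' / t'\<close>, then \<open>u w\<close> witnesses that the sums agree.
\<close>

lemma fraction_add:
  assumes M: "module R M" and xy: "x \<in> carrier M" "y \<in> carrier M" "s \<in> S" "t \<in> S"
  shows "fraction R S M x s \<oplus>\<^bsub>localized_module R S M\<^esub> fraction R S M y t =
    fraction R S M (t \<odot>\<^bsub>M\<^esub> x \<oplus>\<^bsub>M\<^esub> s \<odot>\<^bsub>M\<^esub> y) (s \<otimes> t)"
proof -
  interpret M: module R M by fact
  have cong: "fraction R S M (t' \<odot>\<^bsub>M\<^esub> x' \<oplus>\<^bsub>M\<^esub> s' \<odot>\<^bsub>M\<^esub> y') (s' \<otimes> t') = fraction R S M (t \<odot>\<^bsub>M\<^esub> x \<oplus>\<^bsub>M\<^esub> s \<odot>\<^bsub>M\<^esub> y) (s \<otimes> t)"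
    if "x \<in> carrier M" "y \<in> carrier M" "s \<in> S" "t \<in> S"
      and "x' \<in> carrier M" "y' \<in> carrier M" "s' \<in> S" "t' \<in> S" "u \<in> S" "w \<in> S"
      and u: "u \<odot>\<^bsub>M\<^esub> (s' \<odot>\<^bsub>M\<^esub> x) = u \<odot>\<^bsub>M\<^esub> (s \<odot>\<^bsub>M\<^esub> x')" and w: "w \<odot>\<^bsub>M\<^esub> (t' \<odot>\<^bsub>M\<^esub> y) = w \<odot>\<^bsub>M\<^esub> (t \<odot>\<^bsub>M\<^esub> y')"
    for x y s t x' y' s' t' u w
  proof -
    note c = that(1-10)
    have "(w \<otimes> t \<otimes> t') \<odot>\<^bsub>M\<^esub> (u \<odot>\<^bsub>M\<^esub> (s' \<odot>\<^bsub>M\<^esub> x)) = (w \<otimes> t \<otimes> t') \<odot>\<^bsub>M\<^esub> (u \<odot>\<^bsub>M\<^esub> (s \<odot>\<^bsub>M\<^esub> x'))"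
      "(u \<otimes> s \<otimes> s') \<odot>\<^bsub>M\<^esub> (w \<odot>\<^bsub>M\<^esub> (t' \<odot>\<^bsub>M\<^esub> y)) = (u \<otimes> s \<otimes> s') \<odot>\<^bsub>M\<^esub> (w \<odot>\<^bsub>M\<^esub> (t \<odot>\<^bsub>M\<^esub> y'))"
      unfolding u w by simp_all
    then have "(u \<otimes> w) \<odot>\<^bsub>M\<^esub> ((s \<otimes> t) \<odot>\<^bsub>M\<^esub> (t' \<odot>\<^bsub>M\<^esub> x' \<oplus>\<^bsub>M\<^esub> s' \<odot>\<^bsub>M\<^esub> y')) =
        (u \<otimes> w) \<odot>\<^bsub>M\<^esub> ((s' \<otimes> t') \<odot>\<^bsub>M\<^esub> (t \<odot>\<^bsub>M\<^esub> x \<oplus>\<^bsub>M\<^esub> s \<odot>\<^bsub>M\<^esub> y))"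
      using c by (simp add: M.smult_r_distr M.smult_assoc1[symmetric] m_ac)
    then show ?thesis
      using c by (subst fraction_eq_iff[OF M]) (auto intro!: bexI[of _ "u \<otimes> w"])
  qed
  have "fraction R S M x s \<oplus>\<^bsub>localized_module R S M\<^esub> fraction R S M y t =
    (\<Union>(x', s')\<in>fraction R S M x s. \<Union>(y', t')\<in>fraction R S M y t.
       fraction R S M (t' \<odot>\<^bsub>M\<^esub> x' \<oplus>\<^bsub>M\<^esub> s' \<odot>\<^bsub>M\<^esub> y') (s' \<otimes> t'))"
    by (simp add: localized_module_def)
  also have "\<dots> = (\<Union>(y', t')\<in>fraction R S M y t. fraction R S M (t' \<odot>\<^bsub>M\<^esub> x \<oplus>\<^bsub>M\<^esub> s \<odot>\<^bsub>M\<^esub> y') (s \<otimes> t'))"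
  proof (rule UN_fraction[OF M xy(1,3)])
    fix x' s' u assume x': "x' \<in> carrier M" "s' \<in> S" "u \<in> S" "u \<odot>\<^bsub>M\<^esub> (s' \<odot>\<^bsub>M\<^esub> x) = u \<odot>\<^bsub>M\<^esub> (s \<odot>\<^bsub>M\<^esub> x')"
    have "fraction R S M (t' \<odot>\<^bsub>M\<^esub> x' \<oplus>\<^bsub>M\<^esub> s' \<odot>\<^bsub>M\<^esub> y') (s' \<otimes> t') = fraction R S M (t' \<odot>\<^bsub>M\<^esub> x \<oplus>\<^bsub>M\<^esub> s \<odot>\<^bsub>M\<^esub> y') (s \<otimes> t')"
      if "(y', t') \<in> fraction R S M y t" for y' t'
      using fraction_member[OF M that] x' xy by (intro cong[where u = u and w = \<one>]) auto
    then show "(\<Union>(y', t')\<in>fraction R S M y t. fraction R S M (t' \<odot>\<^bsub>M\<^esub> x' \<oplus>\<^bsub>M\<^esub> s' \<odot>\<^bsub>M\<^esub> y') (s' \<otimes> t')) =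
      (\<Union>(y', t')\<in>fraction R S M y t. fraction R S M (t' \<odot>\<^bsub>M\<^esub> x \<oplus>\<^bsub>M\<^esub> s \<odot>\<^bsub>M\<^esub> y') (s \<otimes> t'))"
      by (intro SUP_cong) auto
  qed
  also have "\<dots> = fraction R S M (t \<odot>\<^bsub>M\<^esub> x \<oplus>\<^bsub>M\<^esub> s \<odot>\<^bsub>M\<^esub> y) (s \<otimes> t)"
  proof (rule UN_fraction[OF M xy(2,4)])
    fix y' t' w assume "y' \<in> carrier M" "t' \<in> S" "w \<in> S" "w \<odot>\<^bsub>M\<^esub> (t' \<odot>\<^bsub>M\<^esub> y) = w \<odot>\<^bsub>M\<^esub> (t \<odot>\<^bsub>M\<^esub> y')"
    then show "fraction R S M (t' \<odot>\<^bsub>M\<^esub> x \<oplus>\<^bsub>M\<^esub> s \<odot>\<^bsub>M\<^esub> y') (s \<otimes> t') = fraction R S M (t \<odot>\<^bsub>M\<^esub> x \<oplus>\<^bsub>M\<^esub> s \<odot>\<^bsub>M\<^esub> y) (s \<otimes> t)"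
      using xy by (intro cong[where u = \<one> and w = w]) auto
  qed
  finally show ?thesis .
qed

abbreviation ring_fraction where "ring_fraction \<equiv> fraction R S (self_module R)"
abbreviation "R_loc \<equiv> localized_ring R S"

lemma module_R: "module R (self_module R)"
  by (rule module_self_module) (rule is_cring)

lemma fraction_smult:
  assumes M: "module R M" and ay: "a \<in> carrier R" "y \<in> carrier M" "s \<in> S" "t \<in> S"
  shows "ring_fraction a s \<odot>\<^bsub>localized_module R S M\<^esub> fraction R S M y t = fraction R S M (a \<odot>\<^bsub>M\<^esub> y) (s \<otimes> t)"
proof -
  interpret M: module R M by fact
  have cong: "fraction R S M (a' \<odot>\<^bsub>M\<^esub> y') (s' \<otimes> t') = fraction R S M (a \<odot>\<^bsub>M\<^esub> y) (s \<otimes> t)"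
    if "a \<in> carrier R" "y \<in> carrier M" "s \<in> S" "t \<in> S"
      and "a' \<in> carrier R" "y' \<in> carrier M" "s' \<in> S" "t' \<in> S" "u \<in> S" "w \<in> S"
      and u: "u \<otimes> (s' \<otimes> a) = u \<otimes> (s \<otimes> a')" and w: "w \<odot>\<^bsub>M\<^esub> (t' \<odot>\<^bsub>M\<^esub> y) = w \<odot>\<^bsub>M\<^esub> (t \<odot>\<^bsub>M\<^esub> y')"
    for a y s t a' y' s' t' u w
  proof -
    note c = that(1-10)
    have "(u \<otimes> w) \<odot>\<^bsub>M\<^esub> ((s' \<otimes> t') \<odot>\<^bsub>M\<^esub> (a \<odot>\<^bsub>M\<^esub> y)) = (u \<otimes> (s' \<otimes> a)) \<odot>\<^bsub>M\<^esub> (w \<odot>\<^bsub>M\<^esub> (t' \<odot>\<^bsub>M\<^esub> y))"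
      using c by (simp add: M.smult_assoc1[symmetric] m_ac)
    also have "\<dots> = (u \<otimes> w) \<odot>\<^bsub>M\<^esub> ((s \<otimes> t) \<odot>\<^bsub>M\<^esub> (a' \<odot>\<^bsub>M\<^esub> y'))"
      unfolding u w using c by (simp add: M.smult_assoc1[symmetric] m_ac)
    finally show ?thesis
      using c by (subst fraction_eq_iff[OF M]) (auto intro!: bexI[of _ "u \<otimes> w"])
  qed
  have "ring_fraction a s \<odot>\<^bsub>localized_module R S M\<^esub> fraction R S M y t =
    (\<Union>(a', s')\<in>ring_fraction a s. \<Union>(y', t')\<in>fraction R S M y t. fraction R S M (a' \<odot>\<^bsub>M\<^esub> y') (s' \<otimes> t'))"
    by (simp add: localized_module_def)
  also have "\<dots> = (\<Union>(y', t')\<in>fraction R S M y t. fraction R S M (a \<odot>\<^bsub>M\<^esub> y') (s \<otimes> t'))"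
  proof (rule UN_fraction[OF module_R])
    fix a' s' u assume a': "a' \<in> carrier (self_module R)" "s' \<in> S" "u \<in> S"
      "u \<odot>\<^bsub>self_module R\<^esub> (s' \<odot>\<^bsub>self_module R\<^esub> a) = u \<odot>\<^bsub>self_module R\<^esub> (s \<odot>\<^bsub>self_module R\<^esub> a')"
    have "fraction R S M (a' \<odot>\<^bsub>M\<^esub> y') (s' \<otimes> t') = fraction R S M (a \<odot>\<^bsub>M\<^esub> y') (s \<otimes> t')"
      if "(y', t') \<in> fraction R S M y t" for y' t'
      using fraction_member[OF M that] a' ay by (intro cong[where u = u and w = \<one>]) auto
    then show "(\<Union>(y', t')\<in>fraction R S M y t. fraction R S M (a' \<odot>\<^bsub>M\<^esub> y') (s' \<otimes> t')) =
      (\<Union>(y', t')\<in>fraction R S M y t. fraction R S M (a \<odot>\<^bsub>M\<^esub> y') (s \<otimes> t'))"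
      by (intro SUP_cong) auto
  qed (use ay in auto)
  also have "\<dots> = fraction R S M (a \<odot>\<^bsub>M\<^esub> y) (s \<otimes> t)"
  proof (rule UN_fraction[OF M ay(2,4)])
    fix y' t' w assume "y' \<in> carrier M" "t' \<in> S" "w \<in> S" "w \<odot>\<^bsub>M\<^esub> (t' \<odot>\<^bsub>M\<^esub> y) = w \<odot>\<^bsub>M\<^esub> (t \<odot>\<^bsub>M\<^esub> y')"
    then show "fraction R S M (a \<odot>\<^bsub>M\<^esub> y') (s \<otimes> t') = fraction R S M (a \<odot>\<^bsub>M\<^esub> y) (s \<otimes> t)"
      using ay by (intro cong[where u = \<one> and w = w]) auto
  qed
  finally show ?thesis .
qed

lemma abelian_group_localized_module:
  assumes M: "module R M"
  shows "abelian_group (localized_module R S M)"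
proof -
  interpret M: module R M by fact
  show ?thesis
  proof (rule abelian_groupI)
    fix X Y assume "X \<in> carrier (localized_module R S M)" "Y \<in> carrier (localized_module R S M)"
    then show "X \<oplus>\<^bsub>localized_module R S M\<^esub> Y \<in> carrier (localized_module R S M)"
      by (elim fraction_cases) (simp add: fraction_add[OF M])
  next
    fix X Y Z assume "X \<in> carrier (localized_module R S M)" "Y \<in> carrier (localized_module R S M)"
      "Z \<in> carrier (localized_module R S M)"
    then show "X \<oplus>\<^bsub>localized_module R S M\<^esub> Y \<oplus>\<^bsub>localized_module R S M\<^esub> Z =
        X \<oplus>\<^bsub>localized_module R S M\<^esub> (Y \<oplus>\<^bsub>localized_module R S M\<^esub> Z)"
      by (elim fraction_cases)
         (simp add: fraction_add[OF M] M.smult_r_distr M.smult_assoc1[symmetric] m_ac M.M.a_assoc)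
  next
    fix X Y assume "X \<in> carrier (localized_module R S M)" "Y \<in> carrier (localized_module R S M)"
    then show "X \<oplus>\<^bsub>localized_module R S M\<^esub> Y = Y \<oplus>\<^bsub>localized_module R S M\<^esub> X"
      by (elim fraction_cases) (simp add: fraction_add[OF M] m_comm M.M.a_comm)
  next
    fix X assume "X \<in> carrier (localized_module R S M)"
    then show "\<zero>\<^bsub>localized_module R S M\<^esub> \<oplus>\<^bsub>localized_module R S M\<^esub> X = X"
      by (elim fraction_cases) (simp add: localized_module_zero fraction_add[OF M])
  next
    fix X assume "X \<in> carrier (localized_module R S M)"
    then obtain x s where x: "x \<in> carrier M" "s \<in> S" "X = fraction R S M x s" by (rule fraction_cases)
    have "fraction R S M (\<ominus>\<^bsub>M\<^esub> x) s \<oplus>\<^bsub>localized_module R S M\<^esub> X = fraction R S M \<zero>\<^bsub>M\<^esub> \<one>"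
      using x by (simp add: fraction_add[OF M] M.smult_r_minus M.M.l_neg)
         (rule fraction_cancel[OF M], auto)
    with x show "\<exists>Y\<in>carrier (localized_module R S M). Y \<oplus>\<^bsub>localized_module R S M\<^esub> X = \<zero>\<^bsub>localized_module R S M\<^esub>"
      by (intro bexI[of _ "fraction R S M (\<ominus>\<^bsub>M\<^esub> x) s"]) (simp_all add: localized_module_zero)
  qed (simp add: localized_module_zero)
qed

lemma localized_ring_simps:
  "carrier R_loc = carrier (localized_module R S (self_module R))"
  "add R_loc = add (localized_module R S (self_module R))"
  "mult R_loc = smult (localized_module R S (self_module R))"
  "\<zero>\<^bsub>R_loc\<^esub> = \<zero>\<^bsub>localized_module R S (self_module R)\<^esub>"
  "\<one>\<^bsub>R_loc\<^esub> = ring_fraction \<one> \<one>"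
  by (simp_all add: localized_ring_def localized_module_def)

lemma ring_fraction_closed [simp]: "a \<in> carrier R \<Longrightarrow> s \<in> S \<Longrightarrow> ring_fraction a s \<in> carrier R_loc"
  by (simp add: localized_ring_simps)

lemma ring_fraction_cases:
  assumes "X \<in> carrier R_loc"
  obtains a s where "a \<in> carrier R" "s \<in> S" "X = ring_fraction a s"
  using assms unfolding localized_ring_simps by (elim fraction_cases) auto

lemma ring_fraction_add:
  "\<lbrakk>a \<in> carrier R; b \<in> carrier R; s \<in> S; t \<in> S\<rbrakk> \<Longrightarrow>
     ring_fraction a s \<oplus>\<^bsub>R_loc\<^esub> ring_fraction b t = ring_fraction (t \<otimes> a \<oplus> s \<otimes> b) (s \<otimes> t)"
  by (simp add: localized_ring_simps fraction_add[OF module_R])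

lemma ring_fraction_mult:
  "\<lbrakk>a \<in> carrier R; b \<in> carrier R; s \<in> S; t \<in> S\<rbrakk> \<Longrightarrow>
     ring_fraction a s \<otimes>\<^bsub>R_loc\<^esub> ring_fraction b t = ring_fraction (a \<otimes> b) (s \<otimes> t)"
  by (simp add: localized_ring_simps fraction_smult[OF module_R])

text \<open>
  These laws are proved by calculating with fractions, before \<open>R_loc\<close> is known to be a ring: for \<open>M = R\<close> scalar
  multiplication is the multiplication of \<open>R_loc\<close>, so they also supply its ring axioms.
\<close>

lemma localized_smult_laws:
  fixes M
  defines "L \<equiv> localized_module R S M"
  assumes M: "module R M"
  shows "\<lbrakk>A \<in> carrier R_loc; X \<in> carrier L\<rbrakk> \<Longrightarrow> A \<odot>\<^bsub>L\<^esub> X \<in> carrier L"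
    and "\<lbrakk>A \<in> carrier R_loc; B \<in> carrier R_loc; X \<in> carrier L\<rbrakk> \<Longrightarrow>
       (A \<oplus>\<^bsub>R_loc\<^esub> B) \<odot>\<^bsub>L\<^esub> X = A \<odot>\<^bsub>L\<^esub> X \<oplus>\<^bsub>L\<^esub> B \<odot>\<^bsub>L\<^esub> X"
    and "\<lbrakk>A \<in> carrier R_loc; X \<in> carrier L; Y \<in> carrier L\<rbrakk> \<Longrightarrow>
       A \<odot>\<^bsub>L\<^esub> (X \<oplus>\<^bsub>L\<^esub> Y) = A \<odot>\<^bsub>L\<^esub> X \<oplus>\<^bsub>L\<^esub> A \<odot>\<^bsub>L\<^esub> Y"
    and "\<lbrakk>A \<in> carrier R_loc; B \<in> carrier R_loc; X \<in> carrier L\<rbrakk> \<Longrightarrow>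
       (A \<otimes>\<^bsub>R_loc\<^esub> B) \<odot>\<^bsub>L\<^esub> X = A \<odot>\<^bsub>L\<^esub> (B \<odot>\<^bsub>L\<^esub> X)"
    and "X \<in> carrier L \<Longrightarrow> \<one>\<^bsub>R_loc\<^esub> \<odot>\<^bsub>L\<^esub> X = X"
proof -
  interpret M: module R M by fact
  note smult = fraction_smult[OF M, folded L_def] and add = fraction_add[OF M, folded L_def]
    and cases = fraction_cases[where M = M, folded L_def] ring_fraction_cases
    and closed = fraction_closed[where M = M, folded L_def]
  show "A \<odot>\<^bsub>L\<^esub> X \<in> carrier L" if "A \<in> carrier R_loc" "X \<in> carrier L"
    using that by (elim cases) (simp add: smult closed)
  show "(A \<oplus>\<^bsub>R_loc\<^esub> B) \<odot>\<^bsub>L\<^esub> X = A \<odot>\<^bsub>L\<^esub> X \<oplus>\<^bsub>L\<^esub> B \<odot>\<^bsub>L\<^esub> X"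
    if "A \<in> carrier R_loc" "B \<in> carrier R_loc" "X \<in> carrier L"
    using that by (elim cases)
      (simp add: smult add ring_fraction_add, rule fraction_cancel[OF M],
       simp_all add: M.smult_l_distr M.smult_r_distr M.smult_assoc1[symmetric] m_ac)
  show "A \<odot>\<^bsub>L\<^esub> (X \<oplus>\<^bsub>L\<^esub> Y) = A \<odot>\<^bsub>L\<^esub> X \<oplus>\<^bsub>L\<^esub> A \<odot>\<^bsub>L\<^esub> Y"
    if "A \<in> carrier R_loc" "X \<in> carrier L" "Y \<in> carrier L"
    using that by (elim cases)
      (simp add: smult add, rule fraction_cancel[OF M],
       simp_all add: M.smult_r_distr M.smult_assoc1[symmetric] m_ac)
  show "(A \<otimes>\<^bsub>R_loc\<^esub> B) \<odot>\<^bsub>L\<^esub> X = A \<odot>\<^bsub>L\<^esub> (B \<odot>\<^bsub>L\<^esub> X)"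
    if "A \<in> carrier R_loc" "B \<in> carrier R_loc" "X \<in> carrier L"
    using that by (elim cases) (simp add: smult ring_fraction_mult M.smult_assoc1 m_assoc)
  show "\<one>\<^bsub>R_loc\<^esub> \<odot>\<^bsub>L\<^esub> X = X" if "X \<in> carrier L"
    using that by (elim cases) (simp add: localized_ring_simps smult)
qed

lemma cring_localized_ring: "cring R_loc"
proof (rule cringI)
  interpret L: abelian_group "localized_module R S (self_module R)"
    by (rule abelian_group_localized_module[OF module_R])
  note laws = localized_smult_laws[OF module_R, folded localized_ring_simps]
  show "abelian_group R_loc"
  proof (rule abelian_groupI, unfold localized_ring_simps)
    fix X assume "X \<in> carrier (localized_module R S (self_module R))"
    then show "\<exists>Y\<in>carrier (localized_module R S (self_module R)).
        Y \<oplus>\<^bsub>localized_module R S (self_module R)\<^esub> X = \<zero>\<^bsub>localized_module R S (self_module R)\<^esub>"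
      by (intro bexI[of _ "\<ominus>\<^bsub>localized_module R S (self_module R)\<^esub> X"]) (simp_all add: L.l_neg)
  qed (simp_all add: L.a_ac)
  have comm: "A \<otimes>\<^bsub>R_loc\<^esub> B = B \<otimes>\<^bsub>R_loc\<^esub> A" if "A \<in> carrier R_loc" "B \<in> carrier R_loc" for A B
    using that by (elim ring_fraction_cases) (simp add: ring_fraction_mult m_comm)
  have "\<one>\<^bsub>R_loc\<^esub> \<in> carrier R_loc" by (simp add: localized_ring_simps(5))
  then show "comm_monoid R_loc"
    by (intro comm_monoidI) (simp_all add: laws, rule comm)
  fix A B C assume "A \<in> carrier R_loc" "B \<in> carrier R_loc" "C \<in> carrier R_loc"
  then show "(A \<oplus>\<^bsub>R_loc\<^esub> B) \<otimes>\<^bsub>R_loc\<^esub> C = A \<otimes>\<^bsub>R_loc\<^esub> C \<oplus>\<^bsub>R_loc\<^esub> B \<otimes>\<^bsub>R_loc\<^esub> C"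
    by (simp add: laws)
qed

lemma module_localized_module:
  assumes "module R M"
  shows "module R_loc (localized_module R S M)"
  by (rule moduleI) (simp_all add: cring_localized_ring abelian_group_localized_module localized_smult_laws assms)

lemma localized_map_fraction:
  assumes N: "module R N" and M: "module R M" and v: "v \<in> linear_maps R N M" and x: "x \<in> carrier N" "s \<in> S"
  shows "localized_map R S M v (fraction R S N x s) = fraction R S M (v x) s"
  unfolding localized_map_def
proof (rule UN_fraction[OF N x])
  interpret N: module R N by fact
  fix y t u assume y: "y \<in> carrier N" "t \<in> S" "u \<in> S" and "u \<odot>\<^bsub>N\<^esub> (t \<odot>\<^bsub>N\<^esub> x) = u \<odot>\<^bsub>N\<^esub> (s \<odot>\<^bsub>N\<^esub> y)"
  then have "v (u \<odot>\<^bsub>N\<^esub> (t \<odot>\<^bsub>N\<^esub> x)) = v (u \<odot>\<^bsub>N\<^esub> (s \<odot>\<^bsub>N\<^esub> y))" by simp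
  then have "u \<odot>\<^bsub>M\<^esub> (s \<odot>\<^bsub>M\<^esub> v y) = u \<odot>\<^bsub>M\<^esub> (t \<odot>\<^bsub>M\<^esub> v x)"
    using v x y by (simp add: linear_maps_def)
  moreover have "v x \<in> carrier M" "v y \<in> carrier M" using v x y by (auto simp: linear_maps_def)
  ultimately show "fraction R S M (v y) t = fraction R S M (v x) s"
    using x y by (subst fraction_eq_iff[OF M]) (simp_all, rule bexI[of _ u])
qed

lemma localized_map_linear:
  assumes N: "module R N" and M: "module R M" and v: "v \<in> linear_maps R N M"
  shows "localized_map R S M v \<in> linear_maps R_loc (localized_module R S N) (localized_module R S M)"
proof -
  interpret N: module R N by fact
  interpret M: module R M by fact
  have v': "\<And>x. x \<in> carrier N \<Longrightarrow> v x \<in> carrier M"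
    "\<And>x y. \<lbrakk>x \<in> carrier N; y \<in> carrier N\<rbrakk> \<Longrightarrow> v (x \<oplus>\<^bsub>N\<^esub> y) = v x \<oplus>\<^bsub>M\<^esub> v y"
    "\<And>a x. \<lbrakk>a \<in> carrier R; x \<in> carrier N\<rbrakk> \<Longrightarrow> v (a \<odot>\<^bsub>N\<^esub> x) = a \<odot>\<^bsub>M\<^esub> v x"
    using v by (auto simp: linear_maps_def)
  note [simp] = localized_map_fraction[OF N M v] v'
  show ?thesis
    unfolding linear_maps_def
  proof (intro CollectI conjI ballI funcsetI)
    fix X assume "X \<in> carrier (localized_module R S N)"
    then show "localized_map R S M v X \<in> carrier (localized_module R S M)"
      by (elim fraction_cases) simp
  next
    fix X Y assume "X \<in> carrier (localized_module R S N)" "Y \<in> carrier (localized_module R S N)"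
    then show "localized_map R S M v (X \<oplus>\<^bsub>localized_module R S N\<^esub> Y) =
        localized_map R S M v X \<oplus>\<^bsub>localized_module R S M\<^esub> localized_map R S M v Y"
      by (elim fraction_cases) (simp add: fraction_add[OF N] fraction_add[OF M])
  next
    fix A X assume "A \<in> carrier R_loc" "X \<in> carrier (localized_module R S N)"
    then show "localized_map R S M v (A \<odot>\<^bsub>localized_module R S N\<^esub> X) =
        A \<odot>\<^bsub>localized_module R S M\<^esub> localized_map R S M v X"
      by (elim fraction_cases ring_fraction_cases) (simp add: fraction_smult[OF N] fraction_smult[OF M])
  qed
qed

end


section \<open>Purity after localization\<close>

definition restrict_scalars :: "('a \<Rightarrow> 'b) \<Rightarrow> ('b, 'p) module \<Rightarrow> ('a, 'p) module" where
  "restrict_scalars \<phi> P = \<lparr>carrier = carrier P, mult = undefined, one = undefined,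
     zero = \<zero>\<^bsub>P\<^esub>, add = add P, smult = (\<lambda>r y. \<phi> r \<odot>\<^bsub>P\<^esub> y)\<rparr>"

lemma restrict_scalars_simps [simp]:
  "carrier (restrict_scalars \<phi> P) = carrier P" "zero (restrict_scalars \<phi> P) = \<zero>\<^bsub>P\<^esub>"
  "add (restrict_scalars \<phi> P) = add P" "r \<odot>\<^bsub>restrict_scalars \<phi> P\<^esub> y = \<phi> r \<odot>\<^bsub>P\<^esub> y"
  by (simp_all add: restrict_scalars_def)

lemma module_restrict_scalars:
  assumes R: "cring R" and \<phi>: "\<phi> \<in> ring_hom R R'" and P: "module R' P"
  shows "module R (restrict_scalars \<phi> P)"
proof -
  interpret R: cring R by fact
  interpret P: module R' P by fact
  have "abelian_group (restrict_scalars \<phi> P)"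
  proof (rule abelian_groupI)
    fix x assume "x \<in> carrier (restrict_scalars \<phi> P)"
    then show "\<exists>y\<in>carrier (restrict_scalars \<phi> P). y \<oplus>\<^bsub>restrict_scalars \<phi> P\<^esub> x = \<zero>\<^bsub>restrict_scalars \<phi> P\<^esub>"
      by (intro bexI[of _ "\<ominus>\<^bsub>P\<^esub> x"]) (simp_all add: P.M.l_neg)
  qed (simp_all add: P.M.a_ac)
  with R show ?thesis
    using ring_hom_closed[OF \<phi>] ring_hom_add[OF \<phi>] ring_hom_mult[OF \<phi>] ring_hom_one[OF \<phi>]
    by (intro moduleI) (simp_all add: P.smult_l_distr P.smult_r_distr P.smult_assoc1)
qed

context multiplicative_set
begin

abbreviation to_loc where "to_loc a \<equiv> ring_fraction a \<one>"

lemma ring_fraction_cancel: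
  "\<lbrakk>a \<in> carrier R; b \<in> carrier R; s \<in> S; t \<in> S; t \<otimes> a = s \<otimes> b\<rbrakk> \<Longrightarrow> ring_fraction a s = ring_fraction b t"
  by (rule fraction_cancel[OF module_R]) simp_all

lemma to_loc_ring_hom: "to_loc \<in> ring_hom R R_loc"
  by (rule ring_hom_memI) (simp_all add: ring_fraction_mult ring_fraction_add localized_ring_simps(5))

lemma to_loc_inverse_smult:
  assumes P: "module R_loc P" and y: "y \<in> carrier P" and s: "s \<in> S"
  shows "ring_fraction \<one> s \<odot>\<^bsub>P\<^esub> (to_loc s \<odot>\<^bsub>P\<^esub> y) = y"
proof -
  interpret P: module R_loc P by fact
  have "ring_fraction s s = \<one>\<^bsub>R_loc\<^esub>"
    using s unfolding localized_ring_simps(5) by (intro ring_fraction_cancel) auto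
  then show ?thesis using s y by (simp add: P.smult_assoc1[symmetric] ring_fraction_mult)
qed

text \<open>
  For a module \<open>P\<close> over the localization, \<open>m / s \<otimes> y \<mapsto> m \<otimes> (1 / s) y\<close> is a well defined map from the tensor
  product over \<open>R_loc\<close> to the tensor product of \<open>M\<close> and \<open>P\<close> over \<open>R\<close>. Hence the vanishing of \<open>x / 1 \<otimes> y\<close> descends to
  \<open>x \<otimes> y\<close>, and flatness of \<open>M\<close> over \<open>R\<close> can be used without passing to the localized module.
\<close>

lemma kernel_restrict_scalars:
  fixes P :: "(('a \<times> 'a) set, 'p) module"
  assumes M: "module R M" and P: "module R_loc P" and x: "x \<in> carrier M" and y: "y \<in> carrier P"
    and k: "frag_of (fraction R S M x \<one>, y) \<in> tensor_kernel R_loc (localized_module R S M) P"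
  shows "frag_of (x, y) \<in> tensor_kernel R M (restrict_scalars to_loc P)"
proof -
  let ?L = "localized_module R S M" and ?P = "restrict_scalars to_loc P"
  interpret M: module R M by fact
  interpret P: module R_loc P by fact
  interpret L: module R_loc ?L by (rule module_localized_module[OF M])
  interpret LP: module_pair R_loc ?L P by (intro module_pairI L.module_axioms P)
  have RP: "module R ?P"
    by (rule module_restrict_scalars[OF is_cring to_loc_ring_hom P])
  interpret MP: module_pair R M ?P by (intro module_pairI M RP)
  let ?i = "ring_fraction \<one>"
  (* A chosen numerator and denominator; b_fraction shows that the choice is immaterial modulo MP.K. *)
  define num den where "num X = fst (SOME p. fst p \<in> carrier M \<and> snd p \<in> S \<and> X = fraction R S M (fst p) (snd p))"
    and "den X = snd (SOME p. fst p \<in> carrier M \<and> snd p \<in> S \<and> X = fraction R S M (fst p) (snd p))" for X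
  have num_den: "num X \<in> carrier M" "den X \<in> S" "X = fraction R S M (num X) (den X)" if X: "X \<in> carrier ?L" for X
  proof -
    have "\<exists>p. fst p \<in> carrier M \<and> snd p \<in> S \<and> X = fraction R S M (fst p) (snd p)"
      using fraction_cases[OF X] by (metis fst_conv snd_conv)
    from someI_ex[OF this] show "num X \<in> carrier M" "den X \<in> S" "X = fraction R S M (num X) (den X)"
      unfolding num_def den_def by blast+
  qed
  define b where "b = (\<lambda>(X, y). frag_of (num X, ?i (den X) \<odot>\<^bsub>P\<^esub> y))"
  have shift: "MP.teq (frag_of (r \<odot>\<^bsub>M\<^esub> m, ?i (r \<otimes> s) \<odot>\<^bsub>P\<^esub> z)) (frag_of (m, ?i s \<odot>\<^bsub>P\<^esub> z))"
    if "m \<in> carrier M" "r \<in> S" "s \<in> S" "z \<in> carrier P" for m r s z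
  proof -
    have "ring_fraction r (r \<otimes> s) = ?i s"
      using that by (intro ring_fraction_cancel) (auto simp: m_ac)
    then show ?thesis
      using that MP.teq_balanced[of r m "?i (r \<otimes> s) \<odot>\<^bsub>P\<^esub> z"]
      by (simp add: P.smult_assoc1[symmetric] ring_fraction_mult)
  qed
  have b_fraction: "MP.teq (b (fraction R S M m s, z)) (frag_of (m, ?i s \<odot>\<^bsub>P\<^esub> z))"
    if m: "m \<in> carrier M" "s \<in> S" and z: "z \<in> carrier P" for m s z
  proof -
    define m' s' where "m' = num (fraction R S M m s)" and "s' = den (fraction R S M m s)"
    have m': "m' \<in> carrier M" "s' \<in> S" "fraction R S M m s = fraction R S M m' s'"
      using num_den[of "fraction R S M m s"] m by (auto simp: m'_def s'_def)
    then obtain u where u: "u \<in> S" "u \<odot>\<^bsub>M\<^esub> (s' \<odot>\<^bsub>M\<^esub> m) = u \<odot>\<^bsub>M\<^esub> (s \<odot>\<^bsub>M\<^esub> m')"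
      using m fraction_eq_iff[OF M m(1) m'(1) m(2) m'(2)] by blast
    (* Both sides are brought to the common denominator u s s', where u s m' = u s' m. *)
    have "MP.teq (frag_of (m', ?i s' \<odot>\<^bsub>P\<^esub> z)) (frag_of ((u \<otimes> s) \<odot>\<^bsub>M\<^esub> m', ?i (u \<otimes> s \<otimes> s') \<odot>\<^bsub>P\<^esub> z))"
      using m m' u z by (intro MP.teq_sym[OF shift]) auto
    also have "(u \<otimes> s) \<odot>\<^bsub>M\<^esub> m' = (u \<otimes> s') \<odot>\<^bsub>M\<^esub> m"
      using m m' u by (simp add: M.smult_assoc1)
    also have "u \<otimes> s \<otimes> s' = (u \<otimes> s') \<otimes> s"
      using m m' u by (simp add: m_ac)
    also have "MP.teq (frag_of ((u \<otimes> s') \<odot>\<^bsub>M\<^esub> m, ?i ((u \<otimes> s') \<otimes> s) \<odot>\<^bsub>P\<^esub> z)) (frag_of (m, ?i s \<odot>\<^bsub>P\<^esub> z))"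
      using m m' u z by (intro shift) auto
    finally show ?thesis by (simp add: b_def m'_def s'_def)
  qed
  have "frag_extend b (frag_of (fraction R S M x \<one>, y)) \<in> MP.K"
  proof (rule LP.kernel_frag_extend[OF _ _ _ _ _ _ k])
    fix X X' z assume "X \<in> carrier ?L" "X' \<in> carrier ?L" and z: "z \<in> carrier P"
    then obtain m s n t where m: "m \<in> carrier M" "s \<in> S" "X = fraction R S M m s"
      and n: "n \<in> carrier M" "t \<in> S" "X' = fraction R S M n t"
      by (elim fraction_cases) 
    have "MP.teq (b (X \<oplus>\<^bsub>?L\<^esub> X', z)) (frag_of (t \<odot>\<^bsub>M\<^esub> m \<oplus>\<^bsub>M\<^esub> s \<odot>\<^bsub>M\<^esub> n, ?i (s \<otimes> t) \<odot>\<^bsub>P\<^esub> z))"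
      using m n z by (simp add: fraction_add[OF M] b_fraction)
    also have "MP.teq \<dots> (frag_of (t \<odot>\<^bsub>M\<^esub> m, ?i (s \<otimes> t) \<odot>\<^bsub>P\<^esub> z) + frag_of (s \<odot>\<^bsub>M\<^esub> n, ?i (s \<otimes> t) \<odot>\<^bsub>P\<^esub> z))"
      using m n z by (intro MP.teq_add_left) auto
    also have "MP.teq \<dots> (frag_of (m, ?i s \<odot>\<^bsub>P\<^esub> z) + frag_of (n, ?i t \<odot>\<^bsub>P\<^esub> z))"
      using m n z shift[of m t s z] shift[of n s t z] by (intro MP.teq_add) (simp_all add: m_comm)
    also have "MP.teq \<dots> (b (X, z) + b (X', z))"
      using m n z unfolding m(3) n(3) by (intro MP.teq_add MP.teq_sym[OF b_fraction])
    finally show "b (X \<oplus>\<^bsub>?L\<^esub> X', z) - (b (X, z) + b (X', z)) \<in> MP.K" by (simp add: MP.teq_def)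
  next
    fix X z z' assume X: "X \<in> carrier ?L" and z: "z \<in> carrier P" "z' \<in> carrier P"
    then show "b (X, z \<oplus>\<^bsub>P\<^esub> z') - (b (X, z) + b (X, z')) \<in> MP.K"
      using MP.teq_add_right[of "num X" "?i (den X) \<odot>\<^bsub>P\<^esub> z" "?i (den X) \<odot>\<^bsub>P\<^esub> z'"] num_den[OF X]
      by (simp add: b_def P.smult_r_distr MP.teq_def)
  next
    fix A X z assume "A \<in> carrier R_loc" "X \<in> carrier ?L" and z: "z \<in> carrier P"
    then obtain a s m t where a: "a \<in> carrier R" "s \<in> S" "A = ring_fraction a s"
      and m: "m \<in> carrier M" "t \<in> S" "X = fraction R S M m t"
      by (elim fraction_cases ring_fraction_cases)
    have "MP.teq (b (A \<odot>\<^bsub>?L\<^esub> X, z)) (frag_of (a \<odot>\<^bsub>M\<^esub> m, ?i (s \<otimes> t) \<odot>\<^bsub>P\<^esub> z))"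
      using a m z by (simp add: fraction_smult[OF M] b_fraction)
    also have "MP.teq \<dots> (frag_of (m, to_loc a \<odot>\<^bsub>P\<^esub> (?i (s \<otimes> t) \<odot>\<^bsub>P\<^esub> z)))"
      using a m z MP.teq_balanced[of a m "?i (s \<otimes> t) \<odot>\<^bsub>P\<^esub> z"] by simp
    also have "to_loc a \<odot>\<^bsub>P\<^esub> (?i (s \<otimes> t) \<odot>\<^bsub>P\<^esub> z) = ?i t \<odot>\<^bsub>P\<^esub> (A \<odot>\<^bsub>P\<^esub> z)"
      using a m z by (simp add: P.smult_assoc1[symmetric] ring_fraction_mult m_comm)
    also have "MP.teq (frag_of (m, ?i t \<odot>\<^bsub>P\<^esub> (A \<odot>\<^bsub>P\<^esub> z))) (b (X, A \<odot>\<^bsub>P\<^esub> z))"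
      using a m z unfolding m(3) by (intro MP.teq_sym[OF b_fraction]) auto
    finally show "b (A \<odot>\<^bsub>?L\<^esub> X, z) - b (X, A \<odot>\<^bsub>P\<^esub> z) \<in> MP.K" by (simp add: MP.teq_def)
  qed (simp_all add: MP.kernel_add MP.kernel_uminus)
  moreover have "MP.teq (b (fraction R S M x \<one>, y)) (frag_of (x, y))"
    using b_fraction[OF x one_in_S y] P.smult_one[OF y] by (simp add: localized_ring_simps(5))
  ultimately show ?thesis using MP.kernel_cong by simp
qed

lemma ideal_localized_ideal:
  assumes I: "ideal I R"
  shows "ideal ((\<lambda>(a, s). ring_fraction a s) ` (I \<times> S)) R_loc"
proof -
  interpret I: ideal I R by fact
  interpret L: cring R_loc by (rule cring_localized_ring)
  let ?J = "(\<lambda>(a, s). ring_fraction a s) ` (I \<times> S)"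
  have mem: "ring_fraction a s \<in> ?J" if "a \<in> I" "s \<in> S" for a s
    using that by (intro image_eqI[of _ _ "(a, s)"]) auto
  have sub: "?J \<subseteq> carrier R_loc" by (auto simp: I.Icarr)
  have right: "A \<otimes>\<^bsub>R_loc\<^esub> X \<in> ?J" if A: "A \<in> ?J" and X: "X \<in> carrier R_loc" for A X
  proof -
    obtain a s b t where "a \<in> I" "s \<in> S" "A = ring_fraction a s" "b \<in> carrier R" "t \<in> S" "X = ring_fraction b t"
      using A X by (elim ring_fraction_cases) auto
    then show ?thesis using mem[of "a \<otimes> b" "s \<otimes> t"] by (simp add: ring_fraction_mult I.Icarr I.I_r_closed)
  qed
  show ?thesis
  proof (rule idealI)
    show "subgroup ?J (add_monoid R_loc)"
    proof (rule L.add.subgroupI)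
      show "?J \<noteq> {}" using mem[OF I.zero_closed one_in_S] by (metis empty_iff)
      show "\<ominus>\<^bsub>R_loc\<^esub> A \<in> ?J" if "A \<in> ?J" for A
      proof -
        have "\<ominus>\<^bsub>R_loc\<^esub> A = A \<otimes>\<^bsub>R_loc\<^esub> (\<ominus>\<^bsub>R_loc\<^esub> \<one>\<^bsub>R_loc\<^esub>)"
          using subsetD[OF sub that] by (simp add: L.r_minus)
        also have "\<dots> \<in> ?J" using right[OF that] by simp
        finally show ?thesis .
      qed
      show "A \<oplus>\<^bsub>R_loc\<^esub> B \<in> ?J" if AB: "A \<in> ?J" "B \<in> ?J" for A B
      proof -
        obtain a s b t where "a \<in> I" "s \<in> S" "A = ring_fraction a s" "b \<in> I" "t \<in> S" "B = ring_fraction b t"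
          using AB by auto
        then show ?thesis using mem[of "t \<otimes> a \<oplus> s \<otimes> b" "s \<otimes> t"]
          by (simp add: ring_fraction_add I.Icarr I.I_l_closed I.a_closed)
      qed
    qed (use sub in simp)
  next
    fix A X assume A: "A \<in> ?J" and X: "X \<in> carrier R_loc"
    show "A \<otimes>\<^bsub>R_loc\<^esub> X \<in> ?J" using right[OF A X] .
    then show "X \<otimes>\<^bsub>R_loc\<^esub> A \<in> ?J" using L.m_comm[OF X subsetD[OF sub A]] by simp
  qed (rule L.ring_axioms)
qed

lemma fraction_in_localized_ideal_smult:
  assumes M: "module R M" and I: "ideal I R" and x: "x \<in> ideal_smult I M"
  shows "fraction R S M x \<one> \<in> ideal_smult ((\<lambda>(a, s). ring_fraction a s) ` (I \<times> S)) (localized_module R S M)"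
proof -
  let ?J = "(\<lambda>(a, s). ring_fraction a s) ` (I \<times> S)"
  interpret M: module R M by fact
  interpret I: ideal I R by fact
  interpret L: module R_loc "localized_module R S M" by (rule module_localized_module[OF M])
  interpret J: ideal ?J R_loc by (rule ideal_localized_ideal[OF I])
  show ?thesis
    using I.a_subset x
  proof (induction rule: M.ideal_smult_induct)
    case zero
    show ?case by (simp add: localized_module_zero[symmetric])
  next
    case (add_smult y a m)
    have a: "a \<in> carrier R" using add_smult I.Icarr by simp
    have "ring_fraction a \<one> \<in> ?J" using add_smult by (intro image_eqI[of _ _ "(a, \<one>)"]) auto
    moreover have "fraction R S M (y \<oplus>\<^bsub>M\<^esub> a \<odot>\<^bsub>M\<^esub> m) \<one> =
      fraction R S M y \<one> \<oplus>\<^bsub>localized_module R S M\<^esub> ring_fraction a \<one> \<odot>\<^bsub>localized_module R S M\<^esub> fraction R S M m \<one>"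
      using add_smult a by (simp add: fraction_add[OF M] fraction_smult[OF M])
    ultimately show ?case
      using add_smult L.ideal_smult_add_smult[OF J.a_subset] by simp
  qed
qed

text \<open>
  A fraction is encoded by the two-element list of a chosen numerator and denominator; this is where test modules
  over the localization need more room than \<open>carrier R\<close>.
\<close>

lemma localized_ring_universe:
  fixes e :: "'a list \<Rightarrow> 'p"
  assumes e: "inj_on e (lists (carrier R))"
  shows "\<exists>f :: ('a \<times> 'a) set \<Rightarrow> 'p. inj_on f (carrier R_loc)"
proof -
  define f where "f X = (SOME p. p \<in> X)" for X :: "('a \<times> 'a) set"
  have f: "f X \<in> carrier R \<times> S" "X = ring_fraction (fst (f X)) (snd (f X))" if X: "X \<in> carrier R_loc" for X
  proof -
    obtain a s where a: "a \<in> carrier R" "s \<in> S" "X = ring_fraction a s" using X by (rule ring_fraction_cases)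
    then have "(a, s) \<in> X" using fraction_self[OF module_R] by simp
    then have "f X \<in> X" unfolding f_def by (rule someI)
    then have fX: "(fst (f X), snd (f X)) \<in> ring_fraction a s" using a by simp
    from fraction_member[OF module_R fX] show "f X \<in> carrier R \<times> S" by (simp add: mem_Times_iff)
    from fraction_member[OF module_R fX] show "X = ring_fraction (fst (f X)) (snd (f X))"
      unfolding a by (subst fraction_eq_iff[OF module_R]) auto
  qed
  have "inj_on (\<lambda>X. e [fst (f X), snd (f X)]) (carrier R_loc)"
  proof (rule inj_onI)
    fix X Y assume X: "X \<in> carrier R_loc" and Y: "Y \<in> carrier R_loc"
      and eq: "e [fst (f X), snd (f X)] = e [fst (f Y), snd (f Y)]"
    have "[fst (f X), snd (f X)] = [fst (f Y), snd (f Y)]"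
      using f(1)[OF X] f(1)[OF Y] by (intro inj_onD[OF e eq]) (auto simp: mem_Times_iff)
    then show "X = Y" using f(2)[OF X] f(2)[OF Y] by simp
  qed
  then show ?thesis by blast
qed

text \<open>
  The localization of \<open>R\<close> as a module and \<open>R_loc\<close> as a module over itself are different records, but they agree on
  carrier, addition and scalar multiplication, which determine the tensor product.
\<close>

lemma tensor_localized_self:
  "tensor R_loc (localized_module R S (self_module R)) P = tensor R_loc (self_module R_loc) P"
  by (simp add: tensor_def tensor_kernel_def tensor_relators_def localized_ring_simps)

lemma pure_localized_self_iff:
  "pure_map U R_loc (localized_module R S (self_module R)) N w \<longleftrightarrow> pure_map U R_loc (self_module R_loc) N w"
  "cyclically_pure_map U R_loc (localized_module R S (self_module R)) N w \<longleftrightarrow>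
     cyclically_pure_map U R_loc (self_module R_loc) N w"
  by (simp_all add: pure_map_def cyclically_pure_map_def tensor_localized_self)

lemma localized_map_linear_self:
  assumes M: "module R M" and v: "v \<in> linear_maps R (self_module R) M"
  shows "localized_map R S M v \<in> linear_maps R_loc (self_module R_loc) (localized_module R S M)"
    "localized_map R S M v \<one>\<^bsub>R_loc\<^esub> = fraction R S M (v \<one>) \<one>"
  using localized_map_linear[OF module_R M v] localized_map_fraction[OF module_R M v, of \<one> \<one>]
  by (simp_all add: linear_maps_def localized_ring_simps)

text \<open>
  If \<open>v 1 / 1 \<otimes> y = 0\<close>, then \<open>v 1 \<otimes> y = 0\<close> over \<open>R\<close>, so the content of \<open>v 1\<close> is contained in the annihilator of \<open>y\<close> in \<open>R\<close>.
  In particular \<open>s y = 0\<close>, and \<open>s\<close> acts invertibly.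
\<close>

theorem localized_map_pure_if_content_meets:
  fixes M :: "('a, 'm, 's) module_scheme"
  assumes M: "module R M" and flat: "flat_module TYPE('p) R M"
    and v: "v \<in> linear_maps R (self_module R) M"
    and s: "s \<in> S" "s \<in> module_content R M (v \<one>)"
  shows "pure_map TYPE('p) R_loc (localized_module R S (self_module R)) (localized_module R S M) (localized_map R S M v)"
  unfolding pure_localized_self_iff unfolding pure_map_def
proof (intro allI impI)
  fix P :: "(('a \<times> 'a) set, 'p) module" assume P: "module R_loc P"
  interpret P: module R_loc P by fact
  let ?L = "localized_module R S M" and ?w = "localized_map R S M v" and ?P = "restrict_scalars to_loc P"
  have RP: "module R ?P"
    by (rule module_restrict_scalars[OF is_cring to_loc_ring_hom P])
  interpret RP: module R ?P by fact
  have x: "v \<one> \<in> carrier M" using v by (auto simp: linear_maps_def)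
  show "inj_on (tensor_map R_loc ?L P ?w id) (carrier (tensor R_loc (self_module R_loc) P))"
    unfolding inj_on_tensor_map_from_ring_iff[OF module_localized_module[OF M] P localized_map_linear_self(1)[OF M v]]
      localized_map_linear_self(2)[OF M v]
  proof (intro ballI impI)
    fix y assume y: "y \<in> carrier P" and "frag_of (fraction R S M (v \<one>) \<one>, y) \<in> tensor_kernel R_loc ?L P"
    then have "frag_of (v \<one>, y) \<in> tensor_kernel R M ?P"
      by (intro kernel_restrict_scalars[OF M P x y])
    then have "v \<one> \<in> ideal_smult (RP.annihilator y) M"
      using y by (intro flat_annihilator[OF flat M RP x]) auto
    moreover have "ideal (RP.annihilator y) R" using y by (intro RP.annihilator_ideal) simp
    ultimately have "module_content R M (v \<one>) \<subseteq> RP.annihilator y"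
      unfolding module_content_def by (intro Inter_lower) simp
    then have "to_loc s \<odot>\<^bsub>P\<^esub> y = \<zero>\<^bsub>P\<^esub>" using s RP.annihilatorD[of s y] by auto
    then show "y = \<zero>\<^bsub>P\<^esub>" using to_loc_inverse_smult[OF P y s(1)] s by simp
  qed
qed

end

lemma (in primeideal) multiplicative_set_complement: "multiplicative_set R (carrier R - I)"
proof
  show "\<one> \<in> carrier R - I" using I_notcarr one_imp_carrier by auto
  show "s \<otimes> t \<in> carrier R - I" if "s \<in> carrier R - I" "t \<in> carrier R - I" for s t
    using that I_prime by auto
qed auto

lemma (in module) ideal_smult_mono:
  assumes "I \<subseteq> J"
  shows "ideal_smult I M \<subseteq> ideal_smult J M"
  unfolding ideal_smult_def using assms by blast

text \<open>
  If \<open>v 1 \<in> p M\<close>, then \<open>v 1 / 1\<close> lies in the product of the localized module with the ideal \<open>J\<close> of fractions with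
  numerator in \<open>p\<close>. Cyclic purity would make \<open>J\<close> the unit ideal, but \<open>1 = a / s\<close> with \<open>a \<in> p\<close> forces a product of
  elements outside \<open>p\<close> into \<open>p\<close>.
\<close>

theorem localized_map_not_cyclically_pure_if_in_prime_smult:
  fixes R (structure) and M :: "('a, 'm, 's) module_scheme" and e :: "'a list \<Rightarrow> 'p"
  assumes p: "primeideal p R" and e: "inj_on e (lists (carrier R))"
    and M: "module R M" and v: "v \<in> linear_maps R (self_module R) M" and x: "v \<one> \<in> ideal_smult p M"
  shows "\<not> cyclically_pure_map TYPE('p) (localized_ring R (carrier R - p))
    (localized_module R (carrier R - p) (self_module R)) (localized_module R (carrier R - p) M)
    (localized_map R (carrier R - p) M v)"
proof
  let ?S = "carrier R - p"
  interpret p: primeideal p R by fact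
  interpret S: multiplicative_set R ?S by (rule p.multiplicative_set_complement)
  assume "cyclically_pure_map TYPE('p) S.R_loc (localized_module R ?S (self_module R)) (localized_module R ?S M) (localized_map R ?S M v)"
  then have pure: "cyclically_pure_map TYPE('p) S.R_loc (self_module S.R_loc) (localized_module R ?S M) (localized_map R ?S M v)"
    by (simp add: S.pure_localized_self_iff)
  obtain f :: "('a \<times> 'a) set \<Rightarrow> 'p" where f: "inj_on f (carrier S.R_loc)"
    using S.localized_ring_universe[OF e] by blast
  let ?J = "(\<lambda>(a, s). S.ring_fraction a s) ` (p \<times> ?S)"
  have "?J = carrier S.R_loc"
    using S.fraction_in_localized_ideal_smult[OF M p.ideal_axioms x] S.localized_map_linear_self(2)[OF M v]
    by (intro ideal_eq_carrier_if_cyclically_pure[OF f S.module_localized_module[OF M] S.localized_map_linear_self(1)[OF M v] pure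
          S.ideal_localized_ideal[OF p.ideal_axioms]]) simp
  moreover have "S.ring_fraction \<one> \<one> \<in> carrier S.R_loc" by (rule S.ring_fraction_closed[OF _ S.one_in_S]) simp
  ultimately have "S.ring_fraction \<one> \<one> \<in> ?J" by metis
  then obtain a s where a: "a \<in> p" "s \<in> ?S" "S.ring_fraction \<one> \<one> = S.ring_fraction a s" by auto
  then obtain u where u: "u \<in> ?S" "u \<otimes> (s \<otimes> \<one>) = u \<otimes> (\<one> \<otimes> a)"
    using S.fraction_eq_iff[OF S.module_R, of \<one> a \<one> s] S.one_in_S by auto
  then have "u \<otimes> s \<in> p" using a p.I_l_closed[of a u] by (simp add: p.Icarr)
  then show False using S.S_mult[OF u(1) a(2)] by blast
qed

theorem lemma3p69:
  fixes R :: "('a, 'r) ring_scheme" and M :: "('a, 'm, 's) module_scheme" and v :: "'a \<Rightarrow> 'm"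
  assumes universe: "\<exists>e :: 'a list \<Rightarrow> 'p. inj_on e (lists (carrier R))"
    and M: "module R M"
    and flat: "flat_module TYPE('p) R M"
    and v: "v \<in> linear_maps R (self_module R) M"
  shows "(pure_map TYPE('p) R (self_module R) M v \<longleftrightarrow> module_content R M (v \<one>\<^bsub>R\<^esub>) = carrier R) \<and>
    (Ohm_Rush R M \<longrightarrow>
       Pure_locus TYPE('p) R (self_module R) M v = CPure_locus TYPE('p) R (self_module R) M v \<and>
       CPure_locus TYPE('p) R (self_module R) M v = Spec R - vanishing_set R (module_content R M (v \<one>\<^bsub>R\<^esub>)))"
proof -
  obtain e :: "'a list \<Rightarrow> 'p" where e: "inj_on e (lists (carrier R))" using universe by blast
  have "inj_on (\<lambda>a. e [a]) (carrier R)"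
  proof (rule inj_onI)
    fix a b assume "a \<in> carrier R" "b \<in> carrier R" "e [a] = e [b]"
    then show "a = b" using inj_onD[OF e, of "[a]" "[b]"] by simp
  qed
  note part1 = pure_iff_content_eq_carrier[OF this M flat v]
  interpret M: module R M by fact
  have x: "v \<one>\<^bsub>R\<^esub> \<in> carrier M" using v by (auto simp: linear_maps_def)
  let ?c = "module_content R M (v \<one>\<^bsub>R\<^esub>)"
  let ?Pure = "Pure_locus TYPE('p) R (self_module R) M v" and ?CPure = "CPure_locus TYPE('p) R (self_module R) M v"
  (* The loci are compared in a cycle; the Ohm-Rush property closes it by placing v 1 in c M, hence in p M. *)
  have le1: "?Pure \<subseteq> ?CPure"
    by (auto simp: Pure_locus_def CPure_locus_def Let_def pure_imp_cyclically_pure)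
  have le2: "Spec R - vanishing_set R ?c \<subseteq> ?Pure"
  proof
    fix p assume p: "p \<in> Spec R - vanishing_set R ?c"
    then obtain s where s: "s \<in> ?c" "s \<notin> p" by (auto simp: vanishing_set_def)
    have pp: "primeideal p R" using p by (simp add: Spec_def)
    interpret S: multiplicative_set R "carrier R - p"
      using pp by (rule primeideal.multiplicative_set_complement)
    have "?c \<subseteq> carrier R"
      unfolding module_content_def using M.carrier_ideal_smult[OF x] M.R.oneideal by (intro Inter_lower) simp
    then show "p \<in> ?Pure"
      using S.localized_map_pure_if_content_meets[OF M flat v _ s(1)] s p
      by (auto simp: Pure_locus_def)
  qed
  have le3: "?CPure \<subseteq> Spec R - vanishing_set R ?c" if OR: "Ohm_Rush R M"
  proof
    fix p assume p: "p \<in> ?CPure"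
    then have pp: "primeideal p R" by (simp add: CPure_locus_def Spec_def)
    have "\<not> ?c \<subseteq> p"
    proof
      assume "?c \<subseteq> p"
      moreover have "v \<one>\<^bsub>R\<^esub> \<in> ideal_smult ?c M" using OR x by (simp add: Ohm_Rush_def)
      ultimately have "v \<one>\<^bsub>R\<^esub> \<in> ideal_smult p M" using M.ideal_smult_mono by blast
      from localized_map_not_cyclically_pure_if_in_prime_smult[OF pp e M v this] p
      show False by (simp add: CPure_locus_def Let_def)
    qed
    then show "p \<in> Spec R - vanishing_set R ?c" using p by (simp add: CPure_locus_def vanishing_set_def)
  qed
  show ?thesis using part1 le1 le2 le3 by blast
qed

end
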